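(* Let $G$ be a profinite group of type (F). Suppose that there is a proper open subgroup of $G$ that is isomorphic (as a topological group) to $G$ itself. Then, for some prime $p$, $G$ has an infinite abelian pro-$p$ normal subgroup.
   Context: A profinite group $G$ is of type (F) if for every positive integer $n$ it has only finitely many open subgroups of index $n$. All homomorphisms between profinite groups are understood to be continuous. *)

theory Defs
  imports "HOL-Analysis.Analysis" "HOL-Algebra.Coset" "HOL-Computational_Algebra.Primes"
begin

text \<open>The topology is a value of type \<^typ>\<open>'a topology\<close>, so that a subgroup \<open>H\<close> is treated as a
  topological group in its own right via \<open>G\<lparr>carrier := H\<rparr>\<close> and \<open>subtopology T H\<close>.\<close>

locale topological_group = group G for G (structure) +
  fixes T
  assumes topspace_eq: "topspace T = carrier G"
    and continuous_mult: "continuous_map (prod_topology T T) T (\<lambda>(x, y). x \<otimes> y)"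
    and continuous_inv: "continuous_map T T (\<lambda>x. inv x)"

definition totally_disconnected_space :: "'a topology \<Rightarrow> bool" where
  "totally_disconnected_space T \<longleftrightarrow> (\<forall>x \<in> topspace T. connected_component_of_set T x = {x})"

locale profinite_group = topological_group +
  assumes compact: "compact_space T"
    and Hausdorff: "Hausdorff_space T"
    and totally_disconnected: "totally_disconnected_space T"

definition open_subgroup :: "'a set \<Rightarrow> ('a, 'b) monoid_scheme \<Rightarrow> 'a topology \<Rightarrow> bool" where
  "open_subgroup H G T \<longleftrightarrow> subgroup H G \<and> openin T H"

text \<open>The index of \<open>H\<close> in \<open>G\<close> is \<open>card (rcosets\<^bsub>G\<^esub> H)\<close>. As \<^const>\<open>card\<close> is \<open>0\<close> on infinite sets,
  the positivity of \<open>n\<close> and of \<open>p ^ k\<close> below also makes the index finite.\<close>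

definition type_F :: "('a, 'b) monoid_scheme \<Rightarrow> 'a topology \<Rightarrow> bool" where
  "type_F G T \<longleftrightarrow> (\<forall>n::nat. n > 0 \<longrightarrow> finite {H. open_subgroup H G T \<and> card (rcosets\<^bsub>G\<^esub> H) = n})"

definition pro_p_group :: "nat \<Rightarrow> ('a, 'b) monoid_scheme \<Rightarrow> 'a topology \<Rightarrow> bool" where
  "pro_p_group p G T \<longleftrightarrow> profinite_group G T \<and>
     (\<forall>N. N \<lhd> G \<and> openin T N \<longrightarrow> (\<exists>k::nat. card (rcosets\<^bsub>G\<^esub> N) = p ^ k))"

definition topological_group_isomorphic ::
  "('a, 'c) monoid_scheme \<Rightarrow> 'a topology \<Rightarrow> ('b, 'd) monoid_scheme \<Rightarrow> 'b topology \<Rightarrow> bool" where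
  "topological_group_isomorphic G T G' T' \<longleftrightarrow> (\<exists>f. f \<in> iso G G' \<and> homeomorphic_map T T' f)"

end

theory Submission
  imports Defs "HOL-Algebra.Sylow" "HOL-Algebra.Multiplicative_Group"
begin

text \<open>
  Let \<open>\<phi> : G \<rightarrow> G\<close> be an injective endomorphism with open proper image. By type (F), the intersection
  of the open subgroups of index at most \<open>n\<close> is open and preserved by every endomorphism of \<open>G\<close>. Hence
  the elements contracted by \<open>\<phi>\<close> form a closed normal subgroup, on which the contraction is uniform
  and which is not contained in \<open>\<phi>(G)\<close>. Counting cosets of \<open>\<phi>(G)\<close>, choose a minimal nontrivial
  \<open>\<phi>\<close>-saturated closed normal subgroup \<open>N\<close> inside it. The elements of \<open>N\<close> all of whose iterates
  \<open>\<phi>\<^sup>k(x)\<close> have their conjugates in \<open>\<phi>\<^sup>k(G)\<close> form a nontrivial subgroup \<open>A\<close>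
  (\<open>persistent_core\<close>) such that every \<open>\<phi>\<^sup>k(A)\<close> is normal in \<open>G\<close>. The sections \<open>\<phi>\<^sup>k(A) / \<phi>\<^sup>k\<^sup>+\<^sup>1(A)\<close> have bounded size, so by type (F) a single open
  subgroup centralises all of them, and by contraction \<open>N\<close> does. If \<open>N\<close> were not abelian, minimality
  would put some \<open>\<phi>\<^sup>b(N)\<close> into the closed derived subgroup of \<open>N\<close>, and an argument as in Gruen's lemma
  (a perfect group modulo its centre has trivial centre) would improve the bound step by step until
  \<open>N\<close> centralises \<open>A \<supseteq> \<phi>\<^sup>a(N)\<close>, making \<open>N\<close> abelian after all. A Sylow subgroup of \<open>N\<close> is the subgroup
  sought; it is infinite because \<open>\<phi>\<close> maps it injectively into itself and contracts it.
\<close>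

section \<open>Topological and profinite groups\<close>

lemma (in group) rcosets_eq_image: "rcosets H = (\<lambda>x. H #> x) ` carrier G"
  by (auto simp: RCOSETS_def)

lemma (in group) rcos_eq_iff:
  assumes "subgroup H G" "x \<in> carrier G" "y \<in> carrier G"
  shows "H #> x = H #> y \<longleftrightarrow> x \<otimes> inv y \<in> H"
  using assms by (metis is_group rcos_self repr_independence subgroup.rcos_module)

text \<open>Any map whose fibres lie inside single cosets of H bounds the index of H by the size of
  its range. It is applied to coset maps and to orbit maps.\<close>

lemma (in group) card_rcosets_le:
  assumes H: "subgroup H G" and fin: "finite (f ` carrier G)"
    and f: "\<And>x y. x \<in> carrier G \<Longrightarrow> y \<in> carrier G \<Longrightarrow> f x = f y \<Longrightarrow> x \<otimes> inv y \<in> H"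
  shows "finite (rcosets H)" "card (rcosets H) \<le> card (f ` carrier G)"
proof -
  let ?g = "\<lambda>b. H #> (inv_into (carrier G) f b)"
  have "H #> x = ?g (f x)" if "x \<in> carrier G" for x
    using that f H inv_into_into[of "f x" f "carrier G"] f_inv_into_f[of "f x" f "carrier G"]
    by (simp add: rcos_eq_iff)
  then have "rcosets H \<subseteq> ?g ` (f ` carrier G)"
    unfolding rcosets_eq_image by (auto intro!: image_eqI)
  then show "finite (rcosets H)" "card (rcosets H) \<le> card (f ` carrier G)"
    using fin by (auto intro: finite_subset surj_card_le)
qed

lemma (in group) card_rcosets_pos:
  assumes "finite (rcosets H)"
  shows "card (rcosets H) > 0"
  using assms by (auto simp: card_gt_0_iff rcosets_eq_image)

section \<open>Open and closed subgroups of topological groups\<close>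

context topological_group
begin

lemma continuous_map_group_mult:
  assumes "continuous_map X T f" "continuous_map X T g"
  shows "continuous_map X T (\<lambda>x. f x \<otimes> g x)"
proof -
  have "continuous_map X (prod_topology T T) (\<lambda>x. (f x, g x))"
    using assms by (simp add: continuous_map_paired)
  from continuous_map_compose[OF this continuous_mult] show ?thesis
    by (simp add: o_def)
qed

lemma continuous_map_group_inv:
  assumes "continuous_map X T f"
  shows "continuous_map X T (\<lambda>x. inv (f x))"
  using continuous_map_compose[OF assms continuous_inv] by (simp add: o_def)

lemma continuous_map_group_const: "c \<in> carrier G \<Longrightarrow> continuous_map X T (\<lambda>x. c)"
  by (simp add: topspace_eq)

lemmas group_continuous_intros =
  continuous_map_group_mult continuous_map_group_inv continuous_map_group_const

lemma continuous_map_group_id: "continuous_map T T (\<lambda>x. x)"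
  using continuous_map_id by (simp add: id_def)

lemma continuous_map_group_pow:
  "continuous_map X T f \<Longrightarrow> continuous_map X T (\<lambda>x. f x [^] (n::nat))"
  by (induction n) (auto intro: group_continuous_intros simp: topspace_eq)

lemma openin_carrier_preimage:
  "continuous_map T T f \<Longrightarrow> openin T U \<Longrightarrow> openin T {x \<in> carrier G. f x \<in> U}"
  using openin_continuous_map_preimage topspace_eq by fastforce

lemma closedin_carrier_preimage:
  "continuous_map T T f \<Longrightarrow> closedin T U \<Longrightarrow> closedin T {x \<in> carrier G. f x \<in> U}"
  using closedin_continuous_map_preimage topspace_eq by fastforce

lemma open_subgroupI:
  assumes H: "subgroup H G" and V: "openin T V" "\<one> \<in> V" "V \<subseteq> H"
  shows "openin T H"
proof (rule openin_subopen[THEN iffD2], intro ballI)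
  fix x assume x: "x \<in> H"
  have xG: "x \<in> carrier G" by (rule subgroup.mem_carrier[OF H x])
  let ?U = "{y \<in> carrier G. inv x \<otimes> y \<in> V}"
  have "openin T ?U"
    using V xG by (intro openin_carrier_preimage group_continuous_intros continuous_map_group_id) auto
  moreover have "x \<in> ?U" using xG V by simp
  moreover have "?U \<subseteq> H"
  proof
    fix y assume y: "y \<in> ?U"
    then have "inv x \<otimes> y \<in> H" using V by blast
    from subgroup.m_closed[OF H x this] show "y \<in> H" using y xG by (simp flip: m_assoc)
  qed
  ultimately show "\<exists>U. openin T U \<and> x \<in> U \<and> U \<subseteq> H" by blast
qed

lemma openin_rcos:
  assumes "openin T H" "H \<subseteq> carrier G" "x \<in> carrier G" shows "openin T (H #> x)"
proof -
  have "H #> x = {y \<in> carrier G. y \<otimes> inv x \<in> H}"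
    using assms by (force simp: r_coset_def m_assoc intro!: exI[of _ "_ \<otimes> inv x"])
  then show ?thesis
    using assms by (auto intro!: openin_carrier_preimage group_continuous_intros continuous_map_group_id)
qed

lemma closedin_rcos:
  assumes "closedin T H" "H \<subseteq> carrier G" "x \<in> carrier G" shows "closedin T (H #> x)"
proof -
  have "H #> x = {y \<in> carrier G. y \<otimes> inv x \<in> H}"
    using assms by (force simp: r_coset_def m_assoc intro!: exI[of _ "_ \<otimes> inv x"])
  then show ?thesis
    using assms by (auto intro!: closedin_carrier_preimage group_continuous_intros continuous_map_group_id)
qed

lemma subgroup_compl_eq_Union:
  assumes "subgroup H G"
  shows "carrier G - H = \<Union> (rcosets H - {H})"
proof (intro equalityI subsetI)
  fix x assume x: "x \<in> carrier G - H"
  then have "x \<in> H #> x" "H #> x \<in> rcosets H"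
    using assms rcos_self rcosetsI[OF subgroup.subset[OF assms]] by auto
  then show "x \<in> \<Union> (rcosets H - {H})" using x by blast
next
  fix x assume "x \<in> \<Union> (rcosets H - {H})"
  then obtain C where C: "C \<in> rcosets H" "C \<noteq> H" "x \<in> C" by blast
  have "H \<in> rcosets H" using assms is_group subgroup.subgroup_in_rcosets by blast
  then have "C \<inter> H = {}"
    using rcos_disjoint[OF assms] C by (auto simp: pairwise_def disjnt_def)
  then show "x \<in> carrier G - H"
    using C rcosets_part_G[OF assms] by blast
qed

text \<open>The complement is a union of cosets, which are open as translates of H.\<close>

lemma open_subgroup_closed:
  assumes H: "subgroup H G" "openin T H"
  shows "closedin T H"
proof -
  have "openin T (carrier G - H)"
    unfolding subgroup_compl_eq_Union[OF H(1)]
    using H subgroup.subset[OF H(1)] by (intro openin_Union) (auto simp: RCOSETS_def openin_rcos)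
  then show ?thesis using H subgroup.subset topspace_eq closedin_def by metis
qed

text \<open>The complement is a finite union of cosets, which are closed as translates of H.\<close>

lemma closed_subgroup_finite_index_open:
  assumes H: "subgroup H G" "closedin T H" "finite (rcosets H)"
  shows "openin T H"
proof -
  have "closedin T (carrier G - H)"
    unfolding subgroup_compl_eq_Union[OF H(1)]
    using H subgroup.subset[OF H(1)] by (intro closedin_Union) (auto simp: RCOSETS_def closedin_rcos)
  then have "openin T (carrier G - (carrier G - H))" using topspace_eq by (metis openin_diff openin_topspace)
  moreover have "carrier G - (carrier G - H) = H" using subgroup.subset[OF H(1)] by blast
  ultimately show ?thesis by simp
qed

end

section \<open>Small open subgroups of profinite groups\<close>

context profinite_group
begin

lemma open_subgroup_finite_index:
  assumes H: "subgroup H G" "openin T H"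
  shows "finite (rcosets H)"
proof -
  have "\<forall>U\<in>rcosets H. openin T U"
    using H subgroup.subset[OF H(1)] by (auto simp: RCOSETS_def openin_rcos)
  moreover have "topspace T \<subseteq> \<Union> (rcosets H)" using rcosets_part_G[OF H(1)] topspace_eq by simp
  ultimately obtain F where F: "finite F" "F \<subseteq> rcosets H" "topspace T \<subseteq> \<Union>F"
    using compact unfolding compact_space_alt by meson
  \<comment> \<open>Cosets are pairwise disjoint, so a subcover by cosets omits none.\<close>
  have "rcosets H \<subseteq> F"
  proof
    fix C assume C: "C \<in> rcosets H"
    then obtain x where x: "x \<in> carrier G" "C = H #> x" by (auto simp: RCOSETS_def)
    then have xC: "x \<in> C" using H rcos_self by blast
    then obtain D where D: "D \<in> F" "x \<in> D" using F x topspace_eq by blast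
    then have "D \<in> rcosets H" "C \<inter> D \<noteq> {}" using F xC x by auto
    then have "C = D" using rcos_disjoint[OF H(1)] C unfolding pairwise_def disjnt_def by metis
    then show "C \<in> F" using D by simp
  qed
  then show ?thesis using F finite_subset by blast
qed

text \<open>Connected sets have at most one point, so none meets both x and the complement of U; in
  a compact Hausdorff space the cut wire fence theorem then provides a clopen separation.\<close>

lemma clopen_neighbourhood:
  assumes U: "openin T U" "x \<in> U"
  obtains W where "openin T W" "closedin T W" "x \<in> W" "W \<subseteq> U"
proof -
  have xT: "x \<in> topspace T" using U openin_subset by blast
  have "separated_between T {x} (topspace T - U)"
  proof (rule cut_wire_fence_theorem_gen)
    show "compactin T {x}" using xT by simp
    show "disjnt C {x} \<or> disjnt C (topspace T - U)" if "connectedin T C" for C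
    proof (cases "x \<in> C")
      case True
      then have "C \<subseteq> connected_component_of_set T x"
        using connected_component_of_maximal that by metis
      then have "C \<subseteq> {x}" using totally_disconnected xT by (auto simp: totally_disconnected_space_def)
      then show ?thesis using U by (auto simp: disjnt_def)
    qed (simp add: disjnt_def)
  qed (use compact Hausdorff U in auto)
  then obtain W where "closedin T W" "openin T W" "{x} \<subseteq> W" "topspace T - U \<subseteq> topspace T - W"
    unfolding separated_between by blast
  then show thesis using that[of W] openin_subset[of T W] by blast
qed

text \<open>The setwise stabiliser of a clopen neighbourhood of the identity is an open subgroup.\<close>

lemma open_subgroup_neighbourhood:
  assumes U: "openin T U" "\<one> \<in> U"
  obtains H where "subgroup H G" "openin T H" "H \<subseteq> U"
proof -
  obtain W where W: "openin T W" "closedin T W" "\<one> \<in> W" "W \<subseteq> U"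
    using clopen_neighbourhood[OF U] by blast
  have WG: "W \<subseteq> carrier G" using W openin_subset topspace_eq by metis
  let ?P = "{p \<in> topspace (prod_topology T T). (case p of (x, y) \<Rightarrow> x \<otimes> y) \<in> W}"
  have "openin (prod_topology T T) ?P"
    by (rule openin_continuous_map_preimage[OF continuous_mult W(1)])
  moreover have "compactin T W" using W compact closedin_compact_space by blast
  moreover have "{\<one>} \<times> W \<subseteq> ?P" using WG by (auto simp: topspace_eq)
  \<comment> \<open>Compactness of W yields one neighbourhood V of the identity that maps all of W
    into W.\<close>
  ultimately obtain V V' where V: "openin T V" "\<one> \<in> V" "W \<subseteq> V'" "V \<times> V' \<subseteq> ?P"
    using tube_lemma_right[of T T ?P W \<one>] topspace_eq by blast
  have VW: "v \<otimes> w \<in> W" if "v \<in> V" "w \<in> W" for v w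
  proof -
    have "(v, w) \<in> ?P" using V(3,4) that by blast
    then show ?thesis by simp
  qed
  have VG: "V \<subseteq> carrier G" using V openin_subset topspace_eq by metis
  let ?H = "{g \<in> carrier G. (\<forall>w\<in>W. g \<otimes> w \<in> W) \<and> (\<forall>w\<in>W. inv g \<otimes> w \<in> W)}"
  have H: "subgroup ?H G"
  proof
    fix x y assume x: "x \<in> ?H" and y: "y \<in> ?H"
    have "x \<otimes> y \<otimes> w \<in> W \<and> inv (x \<otimes> y) \<otimes> w \<in> W" if w: "w \<in> W" for w
    proof -
      have "w \<in> carrier G" using w WG by blast
      then have "x \<otimes> y \<otimes> w = x \<otimes> (y \<otimes> w)" "inv (x \<otimes> y) \<otimes> w = inv y \<otimes> (inv x \<otimes> w)"
        using x y by (auto simp: m_assoc inv_mult_group)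
      then show ?thesis using x y w by simp
    qed
    then show "x \<otimes> y \<in> ?H" using x y by simp
  next
    show "\<one> \<in> ?H" using WG by (auto simp: subset_iff)
  qed auto
  moreover have "openin T ?H"
  proof (rule open_subgroupI[OF H])
    show "openin T (V \<inter> {x \<in> carrier G. inv x \<in> V})"
      using V by (intro openin_Int openin_carrier_preimage continuous_inv) auto
  qed (use V VG VW in auto)
  moreover have "?H \<subseteq> W" using W(3) by force
  ultimately show thesis using that[of ?H] W by blast
qed

end

section \<open>Groups of type (F)\<close>

locale type_F_group = profinite_group +
  assumes type_F: "type_F G T"
begin

definition low_index_subgroups :: "nat \<Rightarrow> 'a set set" where
  "low_index_subgroups n = {H. open_subgroup H G T \<and> card (rcosets H) \<le> n}"

text \<open>Inserting \<open>carrier G\<close> matters only at n = 0, where no open subgroup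
  qualifies and the bare intersection would be the whole type.\<close>

definition index_core :: "nat \<Rightarrow> 'a set" where
  "index_core n = \<Inter>(insert (carrier G) (low_index_subgroups n))"

lemma finite_low_index_subgroups: "finite (low_index_subgroups n)"
proof -
  have "low_index_subgroups n \<subseteq> (\<Union>m\<in>{1..n}. {H. open_subgroup H G T \<and> card (rcosets H) = m})"
  proof
    fix H assume "H \<in> low_index_subgroups n"
    then have H: "open_subgroup H G T" "card (rcosets H) \<le> n"
      by (auto simp: low_index_subgroups_def)
    then have "card (rcosets H) > 0"
      by (auto intro!: card_rcosets_pos open_subgroup_finite_index simp: open_subgroup_def)
    with H show "H \<in> (\<Union>m\<in>{1..n}. {H. open_subgroup H G T \<and> card (rcosets H) = m})"
      by (auto simp: Suc_le_eq)
  qed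
  moreover have "finite (\<Union>m\<in>{1..n}. {H. open_subgroup H G T \<and> card (rcosets H) = m})"
    using type_F by (auto simp: type_F_def)
  ultimately show ?thesis by (rule finite_subset)
qed

lemma subgroup_index_core: "subgroup (index_core n) G"
  unfolding index_core_def
  by (rule subgroups_Inter) (auto simp: open_subgroup_def low_index_subgroups_def subgroup_self)

lemma openin_carrier: "openin T (carrier G)"
  by (metis openin_topspace topspace_eq)

lemma openin_index_core: "openin T (index_core n)"
  unfolding index_core_def
  using finite_low_index_subgroups
  by (intro openin_Inter) (auto simp: open_subgroup_def openin_carrier low_index_subgroups_def)

lemma index_core_subset_carrier: "index_core n \<subseteq> carrier G"
  by (auto simp: index_core_def)

lemma index_core_subset:
  "open_subgroup H G T \<Longrightarrow> card (rcosets H) \<le> n \<Longrightarrow> index_core n \<subseteq> H"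
  by (auto simp: index_core_def low_index_subgroups_def)

lemma index_core_antimono: "m \<le> n \<Longrightarrow> index_core n \<subseteq> index_core m"
  by (force simp: index_core_def low_index_subgroups_def)

lemma index_core_neighbourhood:
  assumes "openin T U" "\<one> \<in> U"
  obtains n where "index_core n \<subseteq> U"
proof -
  obtain H where H: "subgroup H G" "openin T H" "H \<subseteq> U"
    using open_subgroup_neighbourhood[OF assms] .
  then have "index_core (card (rcosets H)) \<subseteq> H"
    by (intro index_core_subset) (auto simp: open_subgroup_def)
  then show thesis using H that by blast
qed

text \<open>Cosets of the preimage correspond to those cosets of H that meet the image of f, so the
  index cannot grow.\<close>

lemma open_subgroup_preimage:
  assumes f: "f \<in> hom G G" "continuous_map T T f" and H: "open_subgroup H G T"
  shows "open_subgroup {x \<in> carrier G. f x \<in> H} G T"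
    and "card (rcosets {x \<in> carrier G. f x \<in> H}) \<le> card (rcosets H)"
proof -
  interpret f: group_hom G G f using f by unfold_locales
  let ?K = "{x \<in> carrier G. f x \<in> H}"
  have HG: "subgroup H G" "openin T H" using H by (auto simp: open_subgroup_def)
  interpret H: subgroup H G by fact
  have K: "subgroup ?K G" by unfold_locales auto
  then show "open_subgroup ?K G T" using f HG by (simp add: open_subgroup_def openin_carrier_preimage)
  have fin: "finite (rcosets H)" using HG open_subgroup_finite_index by blast
  have sub: "(\<lambda>x. H #> f x) ` carrier G \<subseteq> rcosets H"
    using f.hom_closed by (auto intro!: rcosetsI HG subgroup.subset)
  have "card (rcosets ?K) \<le> card ((\<lambda>x. H #> f x) ` carrier G)"
    using K fin sub HG by (intro card_rcosets_le) (auto simp: rcos_eq_iff intro: finite_subset)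
  also have "\<dots> \<le> card (rcosets H)" using fin sub card_mono by blast
  finally show "card (rcosets ?K) \<le> card (rcosets H)" .
qed

text \<open>The preimage of an open subgroup of index at most n is again one, hence contains
  \<open>index_core n\<close>. So these cores form a base of fully invariant open neighbourhoods of
  the identity.\<close>

lemma index_core_endomorphism:
  assumes f: "f \<in> hom G G" "continuous_map T T f" and x: "x \<in> index_core n"
  shows "f x \<in> index_core n"
proof -
  have xG: "x \<in> carrier G" using x index_core_subset_carrier by blast
  have "f x \<in> H" if "open_subgroup H G T" "card (rcosets H) \<le> n" for H
  proof -
    have "index_core n \<subseteq> {x \<in> carrier G. f x \<in> H}"
      using open_subgroup_preimage[OF f that(1)] that(2) by (intro index_core_subset) auto
    then show ?thesis using x by blast
  qed
  moreover have "f x \<in> carrier G" using f(1) xG by (auto simp: hom_def)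
  ultimately show ?thesis by (auto simp: index_core_def low_index_subgroups_def)
qed

lemma normal_index_core: "index_core n \<lhd> G"
proof -
  have "g \<otimes> h \<otimes> inv g \<in> index_core n" if g: "g \<in> carrier G" and h: "h \<in> index_core n" for g h
  proof (rule index_core_endomorphism[where f="\<lambda>h. g \<otimes> h \<otimes> inv g", OF _ _ h])
    show "(\<lambda>h. g \<otimes> h \<otimes> inv g) \<in> hom G G"
      using g by (auto simp: hom_def m_assoc) (simp add: m_assoc [symmetric])
    show "continuous_map T T (\<lambda>h. g \<otimes> h \<otimes> inv g)"
      using g by (intro group_continuous_intros continuous_map_group_id) auto
  qed
  then show ?thesis using normal_inv_iff subgroup_index_core by blast
qed

lemma closedin_index_core: "closedin T (index_core n)"
  by (intro open_subgroup_closed subgroup_index_core openin_index_core)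

end

section \<open>Open self-embeddings\<close>

locale open_self_embedding = type_F_group +
  fixes \<phi>
  assumes hom: "\<phi> \<in> hom G G"
    and inj: "inj_on \<phi> (carrier G)"
    and continuous: "continuous_map T T \<phi>"
    and open_image: "openin T (\<phi> ` carrier G)"
begin

sublocale \<phi>: group_hom G G \<phi>
  using hom by unfold_locales

lemma iterate_hom: "\<phi> ^^ k \<in> hom G G"
proof (induction k)
  case (Suc k)
  then show ?case using hom by (auto simp: hom_def Pi_iff)
qed (simp add: hom_def)

lemma iterate_continuous: "continuous_map T T (\<phi> ^^ k)"
proof (induction k)
  case 0 then show ?case using continuous_map_id by (simp add: id_def)
next
  case (Suc k) show ?case using continuous_map_compose[OF Suc continuous] by (simp add: o_def)
qed

sublocale it: group_hom G G "\<phi> ^^ k" for k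
  using iterate_hom by unfold_locales

lemma iterate_inj: "inj_on (\<phi> ^^ k) (carrier G)"
proof (induction k)
  case (Suc k)
  have "(\<phi> ^^ k) ` carrier G \<subseteq> carrier G" by auto
  from comp_inj_on[OF Suc inj_on_subset[OF inj this]] show ?case by (simp add: o_def)
qed auto

lemma iterate_eq_iff:
  "x \<in> carrier G \<Longrightarrow> y \<in> carrier G \<Longrightarrow> (\<phi> ^^ k) x = (\<phi> ^^ k) y \<longleftrightarrow> x = y"
  using inj_on_eq_iff[OF iterate_inj] .

lemma iterate_add: "(\<phi> ^^ k) ((\<phi> ^^ j) x) = (\<phi> ^^ (k + j)) x"
  by (simp add: funpow_add)

lemma iterate_image_add: "(\<phi> ^^ k) ` ((\<phi> ^^ j) ` S) = (\<phi> ^^ (k + j)) ` S"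
  by (simp add: funpow_add image_comp)

lemma iterate_closed_image:
  assumes "closedin T C" shows "closedin T ((\<phi> ^^ k) ` C)"
  using continuous_imp_closed_map[OF iterate_continuous compact Hausdorff] assms
  by (simp add: closed_map_def)

text \<open>\<phi> is injective and, going from a compact to a Hausdorff space, closed; so the image
  of U is the open set \<phi>(G) minus the closed image of the complement.\<close>

lemma openin_image:
  assumes U: "openin T U" shows "openin T (\<phi> ` U)"
proof -
  have UG: "U \<subseteq> carrier G" using openin_subset[OF U] topspace_eq by simp
  have "closedin T (carrier G - U)"
    using closedin_diff[OF closedin_topspace U] topspace_eq by simp
  then have "closedin T (\<phi> ` (carrier G - U))" using iterate_closed_image[of _ 1] by simp
  moreover have "\<phi> ` U = \<phi> ` carrier G - \<phi> ` (carrier G - U)"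
    using UG by (simp add: inj_on_image_set_diff[OF inj]) blast
  ultimately show ?thesis using open_image by auto
qed

lemma openin_iterate_image: "openin T U \<Longrightarrow> openin T ((\<phi> ^^ k) ` U)"
proof (induction k)
  case (Suc k)
  then show ?case using openin_image[of "(\<phi> ^^ k) ` U"] by (simp add: image_comp)
qed auto

lemma openin_iterate_carrier: "openin T ((\<phi> ^^ k) ` carrier G)"
  by (intro openin_iterate_image openin_carrier)

lemma subgroup_iterate_image:
  "subgroup H G \<Longrightarrow> subgroup ((\<phi> ^^ k) ` H) G"
  by (rule it.subgroup_img_is_subgroup)

lemma iterate_carrier_antimono: "j \<le> k \<Longrightarrow> (\<phi> ^^ k) ` carrier G \<subseteq> (\<phi> ^^ j) ` carrier G"
  by (auto simp: le_iff_add simp flip: iterate_add)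

lemma iterate_index_core: "x \<in> index_core n \<Longrightarrow> (\<phi> ^^ k) x \<in> index_core n"
  by (rule index_core_endomorphism[OF iterate_hom iterate_continuous])

section \<open>The contraction subgroup of \<phi>\<close>

definition level :: "nat \<Rightarrow> 'a set" where
  "level n = {x \<in> carrier G. \<exists>k. (\<phi> ^^ k) x \<in> index_core n}"

definition contracted :: "'a set" where
  "contracted = (\<Inter>n. level n)"

lemma iterate_index_core_mono:
  assumes "(\<phi> ^^ j) x \<in> index_core n" "j \<le> k" shows "(\<phi> ^^ k) x \<in> index_core n"
  using assms iterate_index_core[OF assms(1), of "k - j"] by (simp add: iterate_add)

text \<open>The preimages of \<open>index_core n\<close> under the iterates increase and are open
  subgroups of bounded index. Type (F) leaves finitely many of these, so the chain is stationary and
  one exponent serves all elements.\<close>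

lemma level_uniform:
  obtains k where "level n = {x \<in> carrier G. (\<phi> ^^ k) x \<in> index_core n}"
proof -
  define P where "P k = {x \<in> carrier G. (\<phi> ^^ k) x \<in> index_core n}" for k
  have mono: "P j \<subseteq> P k" if "j \<le> k" for j k
    using iterate_index_core_mono that by (auto simp: P_def)
  have os: "open_subgroup (index_core n) G T"
    using subgroup_index_core openin_index_core by (simp add: open_subgroup_def)
  have "range P \<subseteq> low_index_subgroups (card (rcosets (index_core n)))"
    using open_subgroup_preimage[OF iterate_hom iterate_continuous os]
    by (auto simp: P_def low_index_subgroups_def)
  then have "finite (range P)" by (rule finite_subset) (rule finite_low_index_subgroups)
  then obtain F where F: "finite F" "range P = P ` F"
    using finite_subset_image[of "range P" P UNIV] by auto
  have "P j \<subseteq> P (Max F)" for j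
  proof -
    have "P j \<in> P ` F" using F(2) by blast
    then obtain i where i: "i \<in> F" "P j = P i" by blast
    then show ?thesis using mono[OF Max_ge[OF F(1) i(1)]] by simp
  qed
  then have "\<Union>(range P) = P (Max F)" by blast
  then show thesis using that[of "Max F"] by (auto simp: level_def P_def)
qed

end

lemma (in group) normal_conj_closed:
  "N \<lhd> G \<Longrightarrow> g \<in> carrier G \<Longrightarrow> x \<in> N \<Longrightarrow> g \<otimes> x \<otimes> inv g \<in> N"
  by (rule normal.inv_op_closed2)

lemma (in group) normalI_conj:
  "subgroup N G \<Longrightarrow> (\<And>g x. g \<in> carrier G \<Longrightarrow> x \<in> N \<Longrightarrow> g \<otimes> x \<otimes> inv g \<in> N) \<Longrightarrow> N \<lhd> G"
  by (simp add: normal_inv_iff)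

lemma (in group) normal_Inter:
  assumes "A \<noteq> {}" "\<And>N. N \<in> A \<Longrightarrow> N \<lhd> G"
  shows "\<Inter>A \<lhd> G"
proof (rule normalI_conj)
  show "subgroup (\<Inter>A) G"
    using assms by (intro subgroups_Inter) (auto intro: normal_imp_subgroup)
  show "g \<otimes> x \<otimes> inv g \<in> \<Inter>A" if "g \<in> carrier G" "x \<in> \<Inter>A" for g x
    using that assms by (auto intro: normal_conj_closed)
qed

context open_self_embedding
begin

lemma normal_preimage:
  assumes "N \<lhd> G" shows "{x \<in> carrier G. (\<phi> ^^ k) x \<in> N} \<lhd> G"
proof (rule normalI_conj)
  interpret N: normal N G by fact
  show "subgroup {x \<in> carrier G. (\<phi> ^^ k) x \<in> N} G"
    by unfold_locales auto
  show "g \<otimes> x \<otimes> inv g \<in> {x \<in> carrier G. (\<phi> ^^ k) x \<in> N}"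
    if "g \<in> carrier G" "x \<in> {x \<in> carrier G. (\<phi> ^^ k) x \<in> N}" for g x
    using that by (auto intro: N.inv_op_closed2)
qed

lemma normal_level: "level n \<lhd> G"
  by (rule level_uniform[of n]) (simp add: normal_preimage normal_index_core)

lemma closedin_level: "closedin T (level n)"
  by (rule level_uniform[of n])
    (simp add: closedin_carrier_preimage iterate_continuous closedin_index_core)

lemma level_iff:
  assumes x: "x \<in> carrier G"
  shows "\<phi> x \<in> level n \<longleftrightarrow> x \<in> level n"
proof
  assume "\<phi> x \<in> level n"
  then obtain k where "(\<phi> ^^ k) (\<phi> x) \<in> index_core n" by (auto simp: level_def)
  then have "(\<phi> ^^ Suc k) x \<in> index_core n" by (simp add: funpow_swap1)
  then show "x \<in> level n" using x unfolding level_def by blast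
next
  assume "x \<in> level n"
  then obtain k where "(\<phi> ^^ k) x \<in> index_core n" by (auto simp: level_def)
  then have "(\<phi> ^^ Suc k) x \<in> index_core n" by (rule iterate_index_core_mono) simp
  then have "(\<phi> ^^ k) (\<phi> x) \<in> index_core n" by (simp add: funpow_swap1)
  then show "\<phi> x \<in> level n" using x by (auto simp: level_def)
qed

lemma level_antimono: "m \<le> n \<Longrightarrow> level n \<subseteq> level m"
  using index_core_antimono by (auto simp: level_def)

text \<open>Pigeonhole: two iterates of \<open>x\<close> agree modulo \<open>index_core n\<close>.\<close>

lemma level_iterate_factor:
  assumes x: "x \<in> carrier G"
  obtains d where "x \<otimes> inv ((\<phi> ^^ Suc d) x) \<in> level n"
proof -
  let ?f = "\<lambda>i. index_core n #> (\<phi> ^^ i) x"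
  have "range ?f \<subseteq> rcosets (index_core n)"
    using x index_core_subset_carrier by (auto intro!: rcosetsI)
  moreover have "finite (rcosets (index_core n))"
    by (intro open_subgroup_finite_index subgroup_index_core openin_index_core)
  ultimately have "finite (range ?f)" by (rule finite_subset)
  then have "\<not> inj ?f" using finite_imageD infinite_UNIV_nat by blast
  then obtain i j where ij: "i < j" "?f i = ?f j"
    by (auto simp: inj_def) (metis linorder_less_linear)
  \<comment> \<open>The exponent is written \<open>Suc d\<close> to record that it is positive; this
    puts the factor \<phi>^(d+1)(x) into \<phi>(G).\<close>
  define d where "d = j - i - 1"
  have j: "j = i + Suc d" using ij by (simp add: d_def)
  have "(\<phi> ^^ i) x \<otimes> inv ((\<phi> ^^ j) x) \<in> index_core n"
    using ij(2) x by (simp add: rcos_eq_iff subgroup_index_core)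
  moreover have "(\<phi> ^^ i) (x \<otimes> inv ((\<phi> ^^ Suc d) x)) = (\<phi> ^^ i) x \<otimes> inv ((\<phi> ^^ j) x)"
    using x by (simp only: it.hom_mult it.hom_inv it.hom_closed inv_closed iterate_add j)
  ultimately have "(\<phi> ^^ i) (x \<otimes> inv ((\<phi> ^^ Suc d) x)) \<in> index_core n" by (simp only:)
  moreover have "x \<otimes> inv ((\<phi> ^^ Suc d) x) \<in> carrier G"
    using x by (intro m_closed inv_closed it.hom_closed)
  ultimately have "x \<otimes> inv ((\<phi> ^^ Suc d) x) \<in> level n"
    unfolding level_def by blast
  then show thesis by (rule that)
qed

lemma normal_contracted: "contracted \<lhd> G"
  unfolding contracted_def by (rule normal_Inter) (auto simp: normal_level)

lemma closedin_contracted: "closedin T contracted"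
  unfolding contracted_def by (auto simp: closedin_level)

lemma contracted_subset_carrier: "contracted \<subseteq> carrier G"
  by (auto simp: contracted_def level_def)

lemma contracted_iff: "x \<in> carrier G \<Longrightarrow> \<phi> x \<in> contracted \<longleftrightarrow> x \<in> contracted"
  by (simp add: contracted_def level_iff)

lemma contracted_uniform:
  assumes "openin T U" "\<one> \<in> U"
  obtains k where "\<And>j x. k \<le> j \<Longrightarrow> x \<in> contracted \<Longrightarrow> (\<phi> ^^ j) x \<in> U"
proof -
  obtain n where n: "index_core n \<subseteq> U" using index_core_neighbourhood[OF assms] .
  obtain k where k: "level n = {x \<in> carrier G. (\<phi> ^^ k) x \<in> index_core n}"
    using level_uniform .
  show thesis
  proof (rule that)
    fix j x assume "k \<le> j" "x \<in> contracted"
    then have "(\<phi> ^^ k) x \<in> index_core n" using k by (auto simp: contracted_def)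
    then have "(\<phi> ^^ j) x \<in> index_core n" using \<open>k \<le> j\<close> by (rule iterate_index_core_mono)
    then show "(\<phi> ^^ j) x \<in> U" using n by blast
  qed
qed

text \<open>If x were not the identity, the complement of x would be an open neighbourhood of the
  identity, and uniform contraction would carry \<open>contracted\<close> into it by some
  iterate.\<close>

lemma contracted_eq_one:
  assumes "\<And>k. \<exists>y\<in>contracted. x = (\<phi> ^^ k) y"
  shows "x = \<one>"
proof (rule ccontr)
  assume ne: "x \<noteq> \<one>"
  have x: "x \<in> carrier G" using assms[of 0] contracted_subset_carrier by auto
  have "closedin T {x}" using x Hausdorff
    by (simp add: closedin_Hausdorff_singleton topspace_eq)
  then have "openin T (carrier G - {x})" using openin_diff[OF openin_carrier] by blast
  moreover have "\<one> \<in> carrier G - {x}" using ne by simp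
  ultimately obtain k where "\<And>j y. k \<le> j \<Longrightarrow> y \<in> contracted \<Longrightarrow> (\<phi> ^^ j) y \<in> carrier G - {x}"
    using contracted_uniform by blast
  then show False using assms[of k] by blast
qed

text \<open>Starting from x outside \<phi>(G), \<open>level_iterate_factor\<close> changes x by a
  factor from \<phi>(G) to reach \<open>level n\<close>, still outside \<phi>(G). Compactness passes
  to the intersection over n.\<close>

lemma contracted_not_subset_image:
  assumes proper: "\<phi> ` carrier G \<noteq> carrier G"
  shows "\<not> contracted \<subseteq> \<phi> ` carrier G"
proof -
  interpret im: subgroup "\<phi> ` carrier G" G
    using subgroup_iterate_image[OF subgroup_self, of 1] by simp
  obtain x where x: "x \<in> carrier G" "x \<notin> \<phi> ` carrier G"
    using proper im.subset by blast
  have "level n - \<phi> ` carrier G \<noteq> {}" for n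
  proof -
    obtain d where d: "x \<otimes> inv ((\<phi> ^^ Suc d) x) \<in> level n"
      using level_iterate_factor[OF x(1)] .
    have "x \<otimes> inv ((\<phi> ^^ Suc d) x) \<notin> \<phi> ` carrier G"
    proof
      have im: "(\<phi> ^^ Suc d) x \<in> \<phi> ` carrier G" using x(1) by simp
      assume "x \<otimes> inv ((\<phi> ^^ Suc d) x) \<in> \<phi> ` carrier G"
      from im.m_closed[OF this im] have "x \<in> \<phi> ` carrier G"
        using x(1) it.hom_closed[of x "Suc d"] by (simp add: m_assoc del: funpow.simps)
      then show False using x by blast
    qed
    with d show ?thesis by blast
  qed
  moreover have "closedin T (level n - \<phi> ` carrier G)" for n
    by (intro closedin_diff closedin_level open_image)
  moreover have "decseq (\<lambda>n. level n - \<phi> ` carrier G)"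
    using level_antimono by (auto simp: decseq_def)
  ultimately have "(\<Inter>n. level n - \<phi> ` carrier G) \<noteq> {}"
    using compact_space_imp_nest[OF compact, of "\<lambda>n. level n - \<phi> ` carrier G"] by simp
  then show ?thesis by (auto simp: contracted_def)
qed

text \<open>Substituting the factorisation into itself puts x into \<phi>^i(M) C for every i. Since
  \<phi>^i(M) shrinks uniformly to the identity and C is closed, x lies in C.\<close>

lemma absorb:
  assumes C: "subgroup C G" "closedin T C" "\<phi> ` C \<subseteq> C"
    and M: "M \<subseteq> contracted" "\<And>x. x \<in> M \<Longrightarrow> \<exists>y\<in>M. \<exists>c\<in>C. x = \<phi> y \<otimes> c"
  shows "M \<subseteq> C"
proof
  interpret C: subgroup C G by fact
  have MG: "M \<subseteq> carrier G" using M contracted_subset_carrier by blast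
  fix x assume x: "x \<in> M"
  then have xG: "x \<in> carrier G" using MG by blast
  have step: "\<exists>y\<in>M. \<exists>c\<in>C. x = (\<phi> ^^ i) y \<otimes> c" for i
  proof (induction i)
    case 0
    have "x = (\<phi> ^^ 0) x \<otimes> \<one>" using xG by simp
    then show ?case using x C.one_closed by blast
  next
    case (Suc i)
    then obtain y c where y: "y \<in> M" "c \<in> C" "x = (\<phi> ^^ i) y \<otimes> c" by blast
    obtain z d where z: "z \<in> M" "d \<in> C" "y = \<phi> z \<otimes> d" using M(2)[OF y(1)] by blast
    have "(\<phi> ^^ i) d \<in> C" using C(3) z(2) by (induction i) auto
    moreover have "x = (\<phi> ^^ Suc i) z \<otimes> ((\<phi> ^^ i) d \<otimes> c)"
    proof -
      have "z \<in> carrier G" "d \<in> carrier G" "c \<in> carrier G" using z y MG by auto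
      then have "x = (\<phi> ^^ i) (\<phi> z) \<otimes> (\<phi> ^^ i) d \<otimes> c" using y z by simp
      then show ?thesis using \<open>z \<in> carrier G\<close> \<open>d \<in> carrier G\<close> \<open>c \<in> carrier G\<close>
        by (simp add: m_assoc funpow_swap1)
    qed
    ultimately show ?case using z(1) y(2) by blast
  qed
  show "x \<in> C"
  proof (rule ccontr)
    assume nx: "x \<notin> C"
    let ?U = "{g \<in> carrier G. inv g \<otimes> x \<in> carrier G - C}"
    have "openin T (carrier G - C)" using openin_diff[OF openin_carrier C(2)] .
    then have "openin T ?U"
      using xG by (intro openin_carrier_preimage group_continuous_intros continuous_map_group_id) auto
    moreover have "\<one> \<in> ?U" using nx xG by simp
    ultimately obtain k where k: "\<And>j y. k \<le> j \<Longrightarrow> y \<in> contracted \<Longrightarrow> (\<phi> ^^ j) y \<in> ?U"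
      using contracted_uniform by blast
    obtain y c where y: "y \<in> M" "c \<in> C" "x = (\<phi> ^^ k) y \<otimes> c" using step by blast
    have "(\<phi> ^^ k) y \<in> ?U" using k y M by blast
    then show False using y MG by (auto simp: inv_solve_left m_assoc[symmetric])
  qed
qed

section \<open>Saturated subgroups and the counting of cosets\<close>

definition stable :: "'a set \<Rightarrow> bool" where
  "stable N \<longleftrightarrow> N \<lhd> G \<and> closedin T N \<and> N \<subseteq> contracted \<and> (\<forall>x\<in>carrier G. \<phi> x \<in> N \<longleftrightarrow> x \<in> N)"

text \<open>The number of these cosets that a subgroup of \<open>contracted\<close> meets acts as
  its size: it is bounded, although the subgroups themselves may be infinite.\<close>

abbreviation image_coset :: "'a \<Rightarrow> 'a set" where
  "image_coset x \<equiv> \<phi> ` carrier G #> x"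

lemma stable_contracted: "stable contracted"
  by (simp add: stable_def normal_contracted closedin_contracted contracted_iff)

lemma stable_iterate_iff:
  "stable N \<Longrightarrow> x \<in> carrier G \<Longrightarrow> (\<phi> ^^ k) x \<in> N \<longleftrightarrow> x \<in> N"
  by (induction k) (auto simp: stable_def)

lemma subgroup_image_carrier: "subgroup (\<phi> ` carrier G) G"
  using subgroup_iterate_image[OF subgroup_self, of 1] by simp

lemma finite_image_cosets:
  assumes "M \<subseteq> carrier G"
  shows "finite (image_coset ` M)" "card (image_coset ` M) \<le> card (rcosets (\<phi> ` carrier G))"
proof -
  have "image_coset ` M \<subseteq> rcosets (\<phi> ` carrier G)"
    using assms subgroup.subset[OF subgroup_image_carrier] by (auto intro!: rcosetsI)
  moreover have "finite (rcosets (\<phi> ` carrier G))"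
    by (intro open_subgroup_finite_index subgroup_image_carrier open_image)
  ultimately show "finite (image_coset ` M)" "card (image_coset ` M) \<le> card (rcosets (\<phi> ` carrier G))"
    by (auto intro: finite_subset card_mono)
qed

lemma image_coset_factor:
  assumes "x \<in> carrier G" "C \<subseteq> carrier G" "image_coset x \<in> image_coset ` C"
  obtains y c where "y \<in> carrier G" "c \<in> C" "x = \<phi> y \<otimes> c"
proof -
  obtain c where c: "c \<in> C" "image_coset x = image_coset c" using assms by blast
  then have "x \<in> image_coset c" using rcos_self[OF assms(1) subgroup_image_carrier] by simp
  then show thesis using that c by (auto simp: r_coset_def)
qed

text \<open>Equality of cosets gives x = \<phi>(y) c with c in C. Then \<phi>(y) is in M, saturation
  puts y into M, and \<open>absorb\<close> applies.\<close>

lemma stable_subset_of_image_cosets: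
  assumes M: "stable M" and C: "subgroup C G" "closedin T C" "\<phi> ` C \<subseteq> C" "C \<subseteq> M"
    and le: "image_coset ` M \<subseteq> image_coset ` C"
  shows "M \<subseteq> C"
proof (rule absorb[OF C(1-3)])
  interpret M: normal M G using M by (simp add: stable_def)
  show "M \<subseteq> contracted" using M by (simp add: stable_def)
  fix x assume x: "x \<in> M"
  then have "x \<in> carrier G" "image_coset x \<in> image_coset ` C" using le by auto
  then obtain y c where y: "y \<in> carrier G" "c \<in> C" "x = \<phi> y \<otimes> c"
    using image_coset_factor subgroup.subset[OF C(1)] by metis
  have "c \<in> carrier G" using y C(4) by auto
  then have "\<phi> y = x \<otimes> inv c" using y by (simp add: m_assoc)
  also have "\<dots> \<in> M" using x y C(4) by auto
  finally have "y \<in> M" using M y by (simp add: stable_def)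
  then show "\<exists>y\<in>M. \<exists>c\<in>C. x = \<phi> y \<otimes> c" using y by blast
qed

text \<open>The increasing preimages of C become stationary because the number of cosets of
  \<phi>(G) they meet is bounded; the final one is saturated.\<close>

lemma iterated_preimage_stable:
  assumes C: "C \<lhd> G" "closedin T C" "C \<subseteq> contracted" "\<phi> ` C \<subseteq> C"
  obtains k where "stable {x \<in> carrier G. (\<phi> ^^ k) x \<in> C}"
proof -
  interpret C: normal C G by fact
  define P where "P k = {x \<in> carrier G. (\<phi> ^^ k) x \<in> C}" for k
  have mono: "P j \<subseteq> P k" if "j \<le> k" for j k
  proof -
    have "(\<phi> ^^ i) y \<in> C" if "y \<in> C" for i y using C(4) that by (induction i) auto
    then have "(\<phi> ^^ (k - j)) ((\<phi> ^^ j) x) \<in> C" if "x \<in> P j" for x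
      using that unfolding P_def by blast
    then show ?thesis using that by (auto simp: iterate_add P_def)
  qed
  have normalP: "P k \<lhd> G" for k unfolding P_def by (rule normal_preimage[OF C(1)])
  have closedP: "closedin T (P k)" for k
    unfolding P_def by (intro closedin_carrier_preimage iterate_continuous C(2))
  have PG: "P k \<subseteq> carrier G" for k by (auto simp: P_def)
  have Pc: "P k \<subseteq> contracted" for k
    using C(3) stable_iterate_iff[OF stable_contracted] by (auto simp: P_def)
  have \<phi>P: "\<phi> x \<in> P k \<longleftrightarrow> x \<in> P (Suc k)" if "x \<in> carrier G" for x k
    using that by (simp add: P_def funpow_swap1)
  let ?w = "\<lambda>k. card (image_coset ` P k)"
  \<comment> \<open>A bounded count attains its maximum at some k; from there on the growing P j
    meet no new coset.\<close>
  have "\<forall>k. ?w k < Suc (card (rcosets (\<phi> ` carrier G)))"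
    using finite_image_cosets(2)[OF PG] by (simp add: less_Suc_eq_le)
  then obtain k where k: "\<And>j. ?w j \<le> ?w k"
    using ex_has_greatest_nat[of "\<lambda>_. True" 0 ?w "Suc (card (rcosets (\<phi> ` carrier G)))"] by auto
  have same: "image_coset ` P j = image_coset ` P k" if "k \<le> j" for j
    using card_seteq[OF finite_image_cosets(1)[OF PG[of j]] image_mono[OF mono[OF that]] k[of j]] by simp
  have "\<Union>(range P) \<subseteq> P k"
  \<comment> \<open>Factoring an element of P j yields a y that is only known to lie in P (Suc j),
    hence the union on the left.\<close>
  proof (rule absorb)
    show "subgroup (P k) G" using normalP normal_imp_subgroup by blast
    show "closedin T (P k)" by (rule closedP)
    show "\<phi> ` P k \<subseteq> P k" using \<phi>P[of _ k] PG[of k] mono[of k "Suc k"] by auto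
    show "\<Union>(range P) \<subseteq> contracted" using Pc by blast
    fix x assume "x \<in> \<Union>(range P)"
    then obtain i where "x \<in> P i" by blast
    define j where "j = max i k"
    have x: "x \<in> P j" using \<open>x \<in> P i\<close> mono[of i j] by (auto simp: j_def)
    have kj: "k \<le> j" by (simp add: j_def)
    obtain y c where y: "y \<in> carrier G" "c \<in> P k" "x = \<phi> y \<otimes> c"
      using image_coset_factor[of x "P k"] x PG same[OF kj] by (metis image_eqI subsetD)
    interpret Pj: normal "P j" G by (rule normalP)
    have c: "c \<in> P j" using y mono[OF kj] by blast
    then have "\<phi> y = x \<otimes> inv c" using y by (simp add: m_assoc)
    also have "\<dots> \<in> P j" using x c by auto
    finally have "y \<in> P (Suc j)" using \<phi>P y by simp
    then show "\<exists>y\<in>\<Union>(range P). \<exists>c\<in>P k. x = \<phi> y \<otimes> c" using y by blast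
  qed
  then have "P (Suc k) \<subseteq> P k" by blast
  then have eq: "P (Suc k) = P k" using mono[of k "Suc k"] by simp
  have "stable (P k)"
    unfolding stable_def
  proof (intro conjI ballI)
    show "\<phi> x \<in> P k \<longleftrightarrow> x \<in> P k" if "x \<in> carrier G" for x
      using \<phi>P[OF that, of k] unfolding eq .
  qed (rule normalP closedP Pc)+
  then show thesis using that by (simp add: P_def)
qed

text \<open>A stable nontrivial subgroup with the fewest cosets is chosen; a smaller one meets the
  same cosets and so coincides with it.\<close>

lemma minimal_stable_exists:
  assumes "\<phi> ` carrier G \<noteq> carrier G"
  obtains N where "stable N" "N \<noteq> {\<one>}"
    "\<And>M. stable M \<Longrightarrow> M \<noteq> {\<one>} \<Longrightarrow> M \<subseteq> N \<Longrightarrow> M = N"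
proof -
  let ?w = "\<lambda>N. card (image_coset ` N)"
  have "stable contracted \<and> contracted \<noteq> {\<one>}"
    using stable_contracted contracted_not_subset_image[OF assms]
      subgroup.one_closed[OF subgroup_image_carrier] by auto
  from ex_has_least_nat[of "\<lambda>N. stable N \<and> N \<noteq> {\<one>}", OF this, of ?w]
  obtain N where N: "stable N" "N \<noteq> {\<one>}" "\<And>M. stable M \<Longrightarrow> M \<noteq> {\<one>} \<Longrightarrow> ?w N \<le> ?w M"
    by auto
  show thesis
  proof (rule that[OF N(1,2)])
    fix M assume M: "stable M" "M \<noteq> {\<one>}" "M \<subseteq> N"
    have NG: "N \<subseteq> carrier G" using N(1) contracted_subset_carrier by (auto simp: stable_def)
    have "image_coset ` M = image_coset ` N"
      using card_seteq[OF finite_image_cosets(1)[OF NG] image_mono[OF M(3)] N(3)[OF M(1,2)]] .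
    moreover have "subgroup M G" "closedin T M" "\<phi> ` M \<subseteq> M"
      using M(1) contracted_subset_carrier by (auto simp: stable_def normal_imp_subgroup)
    ultimately have "N \<subseteq> M"
      by (intro stable_subset_of_image_cosets[OF N(1)]) (use M(3) in auto)
    then show "M = N" using M(3) by blast
  qed
qed

end

section \<open>Minimal stable subgroups\<close>

locale minimal_stable = open_self_embedding +
  fixes N
  assumes stable: "stable N"
    and nontrivial: "N \<noteq> {\<one>}"
    and minimal: "\<And>M. stable M \<Longrightarrow> M \<noteq> {\<one>} \<Longrightarrow> M \<subseteq> N \<Longrightarrow> M = N"
begin

lemma normal_N: "N \<lhd> G" and closed_N: "closedin T N" and N_contracted: "N \<subseteq> contracted"
  using stable by (auto simp: stable_def)

sublocale N: normal N G by (rule normal_N)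

lemma iterate_in_N_iff: "x \<in> carrier G \<Longrightarrow> (\<phi> ^^ k) x \<in> N \<longleftrightarrow> x \<in> N"
  by (rule stable_iterate_iff[OF stable])

lemma iterate_in_N [simp]: "x \<in> N \<Longrightarrow> (\<phi> ^^ k) x \<in> N"
  by (simp add: iterate_in_N_iff)

lemma iterate_image_N: "(\<phi> ^^ k) ` N = N \<inter> (\<phi> ^^ k) ` carrier G"
  using iterate_in_N_iff N.subset by auto

lemma N_iterate_eq_one:
  assumes "\<And>k. x \<in> (\<phi> ^^ k) ` N" shows "x = \<one>"
  using assms N_contracted by (intro contracted_eq_one) blast

lemma N_iterate_subset_open:
  assumes "openin T U" "\<one> \<in> U" obtains k where "\<And>j. k \<le> j \<Longrightarrow> (\<phi> ^^ j) ` N \<subseteq> U"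
  using contracted_uniform[OF assms] N_contracted by (metis image_subsetI subsetD)

text \<open>The saturation of C contains C and lies in N, so minimality makes it all of N.\<close>

lemma iterate_N_subset:
  assumes C: "C \<lhd> G" "closedin T C" "C \<subseteq> N" "\<phi> ` C \<subseteq> C" "C \<noteq> {\<one>}"
  obtains k where "(\<phi> ^^ k) ` N \<subseteq> C"
proof -
  obtain k where k: "stable {x \<in> carrier G. (\<phi> ^^ k) x \<in> C}"
    using iterated_preimage_stable[OF C(1,2) _ C(4)] C(3) N_contracted by blast
  let ?M = "{x \<in> carrier G. (\<phi> ^^ k) x \<in> C}"
  interpret C: normal C G by fact
  have "(\<phi> ^^ i) y \<in> C" if "y \<in> C" for i y using C(4) that by (induction i) auto
  then have "C \<subseteq> ?M" by auto
  then have "?M \<noteq> {\<one>}" using C(5) C.one_closed by blast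
  moreover have "?M \<subseteq> N" using C(3) iterate_in_N_iff by auto
  ultimately have "?M = N" using minimal[OF k] by blast
  then show thesis using that[of k] by blast
qed

end

section \<open>Commutators\<close>

definition (in monoid) commutator :: "'a \<Rightarrow> 'a \<Rightarrow> 'a" where
  "commutator x y = x \<otimes> y \<otimes> inv x \<otimes> inv y"

context group
begin

lemma commutator_closed [simp]:
  "x \<in> carrier G \<Longrightarrow> y \<in> carrier G \<Longrightarrow> commutator x y \<in> carrier G"
  by (simp add: commutator_def)

lemma commutator_eq_one_iff:
  assumes "x \<in> carrier G" "y \<in> carrier G"
  shows "commutator x y = \<one> \<longleftrightarrow> x \<otimes> y = y \<otimes> x"
proof -
  have "commutator x y = (x \<otimes> y) \<otimes> inv (y \<otimes> x)"
    using assms by (simp add: commutator_def inv_mult_group m_assoc)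
  moreover have "x \<otimes> y \<in> carrier G" "y \<otimes> x \<in> carrier G" using assms by auto
  ultimately show ?thesis by (metis inv_closed inv_equality inv_inv r_inv)
qed

lemma commutator_swap:
  assumes "x \<in> carrier G" "y \<in> carrier G"
  shows "x \<otimes> y = commutator x y \<otimes> (y \<otimes> x)"
  using assms by (simp add: commutator_def inv_mult_group m_assoc) (simp flip: m_assoc)

lemma commutator_in_normal:
  assumes "M \<lhd> G" "x \<in> carrier G" "y \<in> M"
  shows "commutator x y \<in> M"
proof -
  interpret M: normal M G by fact
  show ?thesis using assms(2,3) by (simp add: commutator_def M.inv_op_closed2)
qed

lemma commutator_conj:
  assumes "g \<in> carrier G" "x \<in> carrier G" "a \<in> carrier G"
  shows "commutator (g \<otimes> x \<otimes> inv g) a = g \<otimes> commutator x (inv g \<otimes> a \<otimes> g) \<otimes> inv g"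
proof -
  have cancel: "inv g \<otimes> (g \<otimes> z) = z" "g \<otimes> (inv g \<otimes> z) = z" if "z \<in> carrier G" for z
    using that assms by (simp_all flip: m_assoc)
  show ?thesis
    using assms by (simp add: commutator_def inv_mult_group m_assoc cancel)
qed

text \<open>Moving a to the left through x y and through y x produces the same prefix v u a, with u
  and v the commutators of x and y with a. Hence a commutes with (y x)^-1 (x y), which is the
  commutator of the inverses.\<close>

lemma commutator_centralizes:
  assumes G: "x \<in> carrier G" "y \<in> carrier G" "a \<in> carrier G"
    and c: "commutator x (commutator y a) = \<one>" "commutator y (commutator x a) = \<one>"
      "commutator (commutator x a) (commutator y a) = \<one>"
  shows "commutator (commutator (inv x) (inv y)) a = \<one>"
proof -
  let ?u = "commutator x a" and ?v = "commutator y a" and ?w = "commutator (inv x) (inv y)"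
  have xv: "x \<otimes> ?v = ?v \<otimes> x" and yu: "y \<otimes> ?u = ?u \<otimes> y" and uv: "?u \<otimes> ?v = ?v \<otimes> ?u"
    using c commutator_eq_one_iff G commutator_closed by blast+
  have xa: "x \<otimes> a = ?u \<otimes> (a \<otimes> x)" and ya: "y \<otimes> a = ?v \<otimes> (a \<otimes> y)"
    by (intro commutator_swap G)+
  have "x \<otimes> y \<otimes> a = x \<otimes> (?v \<otimes> (a \<otimes> y))" using G ya by (simp add: m_assoc)
  also have "\<dots> = (x \<otimes> ?v) \<otimes> a \<otimes> y" using G by (simp add: m_assoc)
  also have "\<dots> = ?v \<otimes> (x \<otimes> a) \<otimes> y" unfolding xv using G by (simp add: m_assoc)
  also have "\<dots> = ?v \<otimes> ?u \<otimes> a \<otimes> (x \<otimes> y)" unfolding xa using G by (simp add: m_assoc)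
  finally have 1: "x \<otimes> y \<otimes> a = ?v \<otimes> ?u \<otimes> a \<otimes> (x \<otimes> y)" .
  have "y \<otimes> x \<otimes> a = y \<otimes> (?u \<otimes> (a \<otimes> x))" using G xa by (simp add: m_assoc)
  also have "\<dots> = (y \<otimes> ?u) \<otimes> a \<otimes> x" using G by (simp add: m_assoc)
  also have "\<dots> = ?u \<otimes> (y \<otimes> a) \<otimes> x" unfolding yu using G by (simp add: m_assoc)
  also have "\<dots> = ?u \<otimes> ?v \<otimes> a \<otimes> (y \<otimes> x)" unfolding ya using G by (simp add: m_assoc)
  finally have 2: "y \<otimes> x \<otimes> a = ?v \<otimes> ?u \<otimes> a \<otimes> (y \<otimes> x)" unfolding uv .
  have 3: "(y \<otimes> x) \<otimes> ?w = x \<otimes> y"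
  proof -
    have "?w = inv (y \<otimes> x) \<otimes> (x \<otimes> y)" using G by (simp add: commutator_def inv_mult_group m_assoc)
    then show ?thesis using G by (simp only: m_assoc[symmetric] m_closed inv_closed r_inv l_one)
  qed
  have "(y \<otimes> x) \<otimes> (?w \<otimes> a) = x \<otimes> y \<otimes> a" using G 3 by (simp flip: m_assoc)
  also have "\<dots> = ?v \<otimes> ?u \<otimes> a \<otimes> (y \<otimes> x) \<otimes> ?w" using G 1 3 by (simp add: m_assoc)
  also have "\<dots> = (y \<otimes> x) \<otimes> (a \<otimes> ?w)" using G 2 by (simp flip: m_assoc)
  finally have "?w \<otimes> a = a \<otimes> ?w" using G by simp
  then show ?thesis using G by (simp add: commutator_eq_one_iff)
qed

text \<open>This is the centraliser of c modulo B; closure rests on [g h, c] = g [h, c] g^-1 [g, c]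
  and normality of B.\<close>

lemma subgroup_commutator_preimage:
  assumes B: "B \<lhd> G" and c: "c \<in> carrier G"
  shows "subgroup {g \<in> carrier G. commutator g c \<in> B} G"
proof -
  interpret B: normal B G by fact
  have mult: "commutator (g \<otimes> h) c = (g \<otimes> commutator h c \<otimes> inv g) \<otimes> commutator g c"
    if "g \<in> carrier G" "h \<in> carrier G" for g h
  proof -
    have cancel: "inv g \<otimes> (g \<otimes> z) = z" "inv c \<otimes> (c \<otimes> z) = z" if "z \<in> carrier G" for z
      using that c \<open>g \<in> carrier G\<close> by (simp_all flip: m_assoc)
    show ?thesis using that c by (simp add: commutator_def inv_mult_group m_assoc cancel)
  qed
  have inv: "commutator (inv g) c = inv g \<otimes> inv (commutator g c) \<otimes> g"
    if "g \<in> carrier G" for g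
  proof -
    have cancel: "inv g \<otimes> (g \<otimes> z) = z" if "z \<in> carrier G" for z
      using that \<open>g \<in> carrier G\<close> by (simp flip: m_assoc)
    show ?thesis using that c by (simp add: commutator_def inv_mult_group m_assoc cancel)
  qed
  show ?thesis
  proof
    show "{g \<in> carrier G. commutator g c \<in> B} \<subseteq> carrier G" by blast
    show "\<one> \<in> {g \<in> carrier G. commutator g c \<in> B}" using c by (simp add: commutator_def)
    fix x y assume "x \<in> {g \<in> carrier G. commutator g c \<in> B}" "y \<in> {g \<in> carrier G. commutator g c \<in> B}"
    then show "x \<otimes> y \<in> {g \<in> carrier G. commutator g c \<in> B}"
      by (simp add: mult B.inv_op_closed2)
  next
    fix x assume "x \<in> {g \<in> carrier G. commutator g c \<in> B}"
    then show "inv x \<in> {g \<in> carrier G. commutator g c \<in> B}"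
      by (simp add: inv B.inv_op_closed1)
  qed
qed

lemma commutator_centralizes_mod:
  assumes B: "B \<lhd> G" and G: "x \<in> carrier G" "y \<in> carrier G" "a \<in> carrier G"
    and c: "commutator x (commutator y a) \<in> B" "commutator y (commutator x a) \<in> B"
      "commutator (commutator x a) (commutator y a) \<in> B"
  shows "commutator (commutator (inv x) (inv y)) a \<in> B"
proof -
  interpret B: normal B G by fact
  interpret Q: group "G Mod B" by (rule B.factorgroup_is_group)
  interpret q: group_hom G "G Mod B" "\<lambda>x. B #> x"
    by unfold_locales (rule B.r_coset_hom_Mod)
  have q: "B #> commutator x y = Q.commutator (B #> x) (B #> y)"
    if "x \<in> carrier G" "y \<in> carrier G" for x y
    using that unfolding commutator_def Q.commutator_def by (simp only: q.hom_mult q.hom_inv m_closed inv_closed)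
  have one: "B #> z = \<one>\<^bsub>G Mod B\<^esub> \<longleftrightarrow> z \<in> B" if "z \<in> carrier G" for z
    using coset_join1[OF _ that B.subgroup_axioms] coset_join2[OF that B.subgroup_axioms]
    unfolding one_FactGroup by blast
  have "Q.commutator (Q.commutator (inv\<^bsub>G Mod B\<^esub> (B #> x)) (inv\<^bsub>G Mod B\<^esub> (B #> y))) (B #> a) = \<one>\<^bsub>G Mod B\<^esub>"
    by (rule Q.commutator_centralizes) (use G c in \<open>simp_all only: q[symmetric] one q.hom_closed commutator_closed\<close>)
  then have "B #> commutator (commutator (inv x) (inv y)) a = \<one>\<^bsub>G Mod B\<^esub>"
    using G by (simp only: q q.hom_inv inv_closed commutator_closed)
  then show ?thesis using G by (simp only: one inv_closed commutator_closed)
qed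

lemma normal_core_of:
  assumes H: "subgroup H G"
  shows "{x \<in> carrier G. \<forall>g\<in>carrier G. g \<otimes> x \<otimes> inv g \<in> H} \<lhd> G"
proof (rule normalI_conj)
  interpret H: subgroup H G by fact
  let ?C = "{x \<in> carrier G. \<forall>g\<in>carrier G. g \<otimes> x \<otimes> inv g \<in> H}"
  have mult: "g \<otimes> (x \<otimes> y) \<otimes> inv g = (g \<otimes> x \<otimes> inv g) \<otimes> (g \<otimes> y \<otimes> inv g)"
    if "g \<in> carrier G" "x \<in> carrier G" "y \<in> carrier G" for g x y
  proof -
    have cancel: "inv g \<otimes> (g \<otimes> z) = z" if "z \<in> carrier G" for z
      using that \<open>g \<in> carrier G\<close> by (simp flip: m_assoc)
    show ?thesis using that by (simp add: m_assoc cancel)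
  qed
  have inv: "g \<otimes> inv x \<otimes> inv g = inv (g \<otimes> x \<otimes> inv g)"
    if "g \<in> carrier G" "x \<in> carrier G" for g x
    using that by (simp add: inv_mult_group m_assoc)
  show "subgroup ?C G"
  proof
    show "?C \<subseteq> carrier G" by blast
    show "\<one> \<in> ?C" by simp
    show "x \<otimes> y \<in> ?C" if "x \<in> ?C" "y \<in> ?C" for x y using that by (simp add: mult)
    show "inv x \<in> ?C" if "x \<in> ?C" for x using that by (simp add: inv)
  qed
  fix g x assume g: "g \<in> carrier G" and x: "x \<in> ?C"
  have "h \<otimes> (g \<otimes> x \<otimes> inv g) \<otimes> inv h \<in> H" if h: "h \<in> carrier G" for h
  proof -
    have "(h \<otimes> g) \<otimes> x \<otimes> inv (h \<otimes> g) \<in> H" using x g h by simp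
    then show ?thesis using x g h by (simp add: inv_mult_group m_assoc)
  qed
  then show "g \<otimes> x \<otimes> inv g \<in> ?C" using g x by simp
qed

end

section \<open>The persistent core\<close>

context minimal_stable
begin

text \<open>The normal core of \<phi>^k(G), that is, the largest normal subgroup of G inside
  it.\<close>

definition image_core :: "nat \<Rightarrow> 'a set" where
  "image_core k = {x \<in> carrier G. \<forall>g\<in>carrier G. g \<otimes> x \<otimes> inv g \<in> (\<phi> ^^ k) ` carrier G}"

text \<open>The image of a normal subgroup under \<phi>^k is in general normal only in \<phi>^k(G).
  The condition on all iterates is what makes the images of this subgroup normal in G.\<close>

definition persistent_core :: "'a set" where
  "persistent_core = {x \<in> N. \<forall>k. (\<phi> ^^ k) x \<in> image_core k}"

lemma subgroup_iterate_carrier: "subgroup ((\<phi> ^^ k) ` carrier G) G"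
  by (intro subgroup_iterate_image subgroup_self)

lemma normal_image_core: "image_core k \<lhd> G"
  unfolding image_core_def by (rule normal_core_of[OF subgroup_iterate_carrier])

lemma image_core_subset: "image_core k \<subseteq> (\<phi> ^^ k) ` carrier G"
proof
  fix x assume "x \<in> image_core k"
  then have "x \<in> carrier G" "\<one> \<otimes> x \<otimes> inv \<one> \<in> (\<phi> ^^ k) ` carrier G"
    unfolding image_core_def by blast+
  then show "x \<in> (\<phi> ^^ k) ` carrier G" by simp
qed

lemma openin_image_core: "openin T (image_core k)"
proof -
  obtain n where n: "index_core n \<subseteq> (\<phi> ^^ k) ` carrier G"
    using index_core_neighbourhood[OF openin_iterate_carrier subgroup.one_closed[OF subgroup_iterate_carrier]] .
  have "index_core n \<subseteq> image_core k"
    using n normal_conj_closed[OF normal_index_core] index_core_subset_carrier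
    unfolding image_core_def by blast
  then show ?thesis
    by (intro open_subgroupI[OF normal_imp_subgroup[OF normal_image_core] openin_index_core])
      (simp_all add: subgroup.one_closed[OF subgroup_index_core])
qed

lemma closedin_image_core: "closedin T (image_core k)"
  by (intro open_subgroup_closed normal_imp_subgroup normal_image_core openin_image_core)

lemma persistent_core_eq: "persistent_core = \<Inter>(insert N (range (\<lambda>k. {x \<in> carrier G. (\<phi> ^^ k) x \<in> image_core k})))"
  using N.subset by (auto simp: persistent_core_def)

lemma normal_persistent_core: "persistent_core \<lhd> G"
  unfolding persistent_core_eq by (rule normal_Inter) (auto intro: normal_preimage normal_image_core normal_N)

lemma closedin_persistent_core: "closedin T persistent_core"
  unfolding persistent_core_eq
  by (rule closedin_Inter)
    (auto intro: closedin_carrier_preimage iterate_continuous closedin_image_core closed_N)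

lemma persistent_core_subset_N: "persistent_core \<subseteq> N"
  by (auto simp: persistent_core_def)

lemma persistent_core_subset_carrier: "persistent_core \<subseteq> carrier G"
  using persistent_core_subset_N N.subset by blast

text \<open>A conjugate of \<phi>^k(a) has the form \<phi>^k(b) because \<phi>^k(a) is in
  \<open>image_core k\<close>. That b is persistent again is checked after applying \<phi>^k, where
  it becomes the condition on \<phi>^(k+j)(a).\<close>

lemma normal_iterate_persistent_core: "(\<phi> ^^ k) ` persistent_core \<lhd> G"
proof (rule normalI_conj)
  show "subgroup ((\<phi> ^^ k) ` persistent_core) G"
    by (intro subgroup_iterate_image normal_imp_subgroup normal_persistent_core)
  fix g x assume g: "g \<in> carrier G" and "x \<in> (\<phi> ^^ k) ` persistent_core"
  then obtain a where a: "a \<in> persistent_core" "x = (\<phi> ^^ k) a" by blast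
  have aN: "a \<in> N" and aG: "a \<in> carrier G" using a persistent_core_subset_N N.subset by auto
  have core: "(\<phi> ^^ j) a \<in> image_core j" for j using a(1) by (simp add: persistent_core_def)
  have "g \<otimes> x \<otimes> inv g \<in> (\<phi> ^^ k) ` carrier G"
    using core[of k] g a unfolding image_core_def by simp
  then obtain b where b: "b \<in> carrier G" "g \<otimes> x \<otimes> inv g = (\<phi> ^^ k) b" by blast
  have "(\<phi> ^^ k) b \<in> N"
    using normal_conj_closed[OF normal_N g] aN a b by (metis iterate_in_N)
  then have "b \<in> N" using b iterate_in_N_iff by blast
  moreover have "(\<phi> ^^ j) b \<in> image_core j" for j
  proof -
    have "h \<otimes> (\<phi> ^^ j) b \<otimes> inv h \<in> (\<phi> ^^ j) ` carrier G" if h: "h \<in> carrier G" for h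
    proof -
      \<comment> \<open>Applying \<phi>^k turns conjugation of \<phi>^j(b) by h into conjugation of
        \<phi>^(k+j)(a) by ?u.\<close>
      let ?u = "(\<phi> ^^ k) h \<otimes> (\<phi> ^^ j) g"
      have "(\<phi> ^^ k) ((\<phi> ^^ j) b) = (\<phi> ^^ j) (g \<otimes> x \<otimes> inv g)"
        by (simp only: b iterate_add add.commute)
      also have "\<dots> = (\<phi> ^^ j) g \<otimes> (\<phi> ^^ (k + j)) a \<otimes> inv ((\<phi> ^^ j) g)"
        using g aG a(2) by (simp add: iterate_add add.commute)
      finally have "(\<phi> ^^ k) (h \<otimes> (\<phi> ^^ j) b \<otimes> inv h) = ?u \<otimes> (\<phi> ^^ (k + j)) a \<otimes> inv ?u"
        using g h b aG by (simp add: inv_mult_group m_assoc)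
      also have "\<dots> \<in> (\<phi> ^^ (k + j)) ` carrier G"
        using core[of "k + j"] g h unfolding image_core_def by simp
      finally obtain z where z: "z \<in> carrier G"
        "(\<phi> ^^ k) (h \<otimes> (\<phi> ^^ j) b \<otimes> inv h) = (\<phi> ^^ k) ((\<phi> ^^ j) z)"
        by (auto simp: iterate_add)
      have "h \<otimes> (\<phi> ^^ j) b \<otimes> inv h = (\<phi> ^^ j) z"
        using z(2) by (rule iterate_eq_iff[THEN iffD1, rotated 2]) (use h b z in auto)
      then show ?thesis using z by blast
    qed
    then show ?thesis using b by (simp add: image_core_def)
  qed
  ultimately have "b \<in> persistent_core" by (simp add: persistent_core_def)
  then show "g \<otimes> x \<otimes> inv g \<in> (\<phi> ^^ k) ` persistent_core" using b by blast
qed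

lemma image_core_image:
  assumes "x \<in> carrier G" "\<phi> x \<in> image_core (Suc k)" shows "x \<in> image_core k"
proof -
  have "h \<otimes> x \<otimes> inv h \<in> (\<phi> ^^ k) ` carrier G" if h: "h \<in> carrier G" for h
  proof -
    have "\<phi> h \<otimes> \<phi> x \<otimes> inv (\<phi> h) \<in> (\<phi> ^^ Suc k) ` carrier G"
      using assms(2) h \<phi>.hom_closed unfolding image_core_def by blast
    then obtain z where z: "z \<in> carrier G" "\<phi> (h \<otimes> x \<otimes> inv h) = \<phi> ((\<phi> ^^ k) z)"
      using h assms by auto
    then have "h \<otimes> x \<otimes> inv h = (\<phi> ^^ k) z"
      using inj h assms by (auto simp: inj_on_def)
    then show ?thesis using z by blast
  qed
  then show ?thesis using assms by (simp add: image_core_def)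
qed

lemma image_core_antimono:
  assumes "j \<le> k" shows "image_core k \<subseteq> image_core j"
  using iterate_carrier_antimono[OF assms] unfolding image_core_def by blast

lemma image_persistent_core_subset: "\<phi> ` persistent_core \<subseteq> persistent_core"
proof
  fix y assume "y \<in> \<phi> ` persistent_core"
  then obtain x where x: "x \<in> persistent_core" "y = \<phi> x" by blast
  have xG: "x \<in> carrier G" using x persistent_core_subset_carrier by blast
  have "(\<phi> ^^ k) y \<in> image_core k" for k
  proof -
    have "(\<phi> ^^ Suc k) x \<in> image_core (Suc k)" using x by (simp only: persistent_core_def mem_Collect_eq)
    then have "(\<phi> ^^ k) y \<in> image_core (Suc k)" using x by (simp add: funpow_swap1)
    moreover have "image_core (Suc k) \<subseteq> image_core k"
      by (rule image_core_antimono) simp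
    ultimately show ?thesis by blast
  qed
  moreover have "y \<in> N" using x persistent_core_subset_N iterate_in_N[of x 1] by auto
  ultimately show "y \<in> persistent_core" by (simp add: persistent_core_def)
qed

lemma iterate_image_N_antimono: "j \<le> k \<Longrightarrow> (\<phi> ^^ k) ` N \<subseteq> (\<phi> ^^ j) ` N"
  using iterate_carrier_antimono[of j k] unfolding iterate_image_N by blast

lemma N_eq_one_of_eventually:
  assumes "\<And>k. k0 \<le> k \<Longrightarrow> x \<in> (\<phi> ^^ k) ` N"
  shows "x = \<one>"
proof (rule N_iterate_eq_one)
  fix k
  have "x \<in> (\<phi> ^^ max k0 k) ` N" by (rule assms) simp
  then show "x \<in> (\<phi> ^^ k) ` N" using iterate_image_N_antimono[of k "max k0 k"] by auto
qed

lemma nontrivial_element: obtains x where "x \<in> N" "x \<noteq> \<one>"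
  using nontrivial N.one_closed by blast

text \<open>If \<open>persistent_core\<close> were trivial, the cores of the images \<open>(\<phi> ^^ k) ` carrier G\<close> would have eventually
  constant intersection with \<open>N\<close>, and this intersection would be trivial although it is open in \<open>N\<close>.\<close>

lemma persistent_core_nontrivial: "persistent_core \<noteq> {\<one>}"
proof
  assume persistent_core: "persistent_core = {\<one>}"
  \<comment> \<open>A common point of all Z k would be an element of \<open>persistent_core\<close>
    outside \<phi>(G), hence not the identity; by compactness some Z k is empty.\<close>
  define Z where "Z k = N \<inter> {x \<in> carrier G. (\<phi> ^^ k) x \<in> image_core k} - \<phi> ` carrier G" for k
  have dec: "Z (Suc k) \<subseteq> Z k" for k
    using image_core_image[of "(\<phi> ^^ k) _" k] by (auto simp: Z_def)
  have "\<exists>k. Z k = {}"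
  proof (rule ccontr)
    assume "\<nexists>k. Z k = {}"
    moreover have "closedin T (Z k)" for k unfolding Z_def
      by (intro closedin_diff closedin_Int closed_N closedin_carrier_preimage iterate_continuous
          closedin_image_core open_image)
    moreover have "decseq Z" using dec by (rule decseq_SucI)
    ultimately obtain x where x: "\<And>k. x \<in> Z k"
      using compact_space_imp_nest[OF compact, of Z] by blast
    then have "x \<in> persistent_core" "x \<notin> \<phi> ` carrier G" by (auto simp: persistent_core_def Z_def)
    then show False using persistent_core subgroup.one_closed[OF subgroup_image_carrier] by simp
  qed
  then obtain k0 where k0: "Z k0 = {}" by blast
  have "Z k = {}" if "k0 \<le> k" for k
    using that by (induction rule: dec_induct) (use k0 dec in auto)
  \<comment> \<open>Emptiness of Z k puts this intersection into \<phi>^(k+1)(G); being normal, it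
    then lies in the normal core.\<close>
  then have step: "N \<inter> image_core k \<subseteq> image_core (Suc k)" if k: "k0 \<le> k" for k
  proof -
    have sub: "N \<inter> image_core k \<subseteq> (\<phi> ^^ Suc k) ` carrier G"
    proof
      fix y assume y: "y \<in> N \<inter> image_core k"
      then obtain x where x: "x \<in> carrier G" "y = (\<phi> ^^ k) x" using image_core_subset by blast
      have "x \<in> N" using iterate_in_N_iff[OF x(1)] x(2) y by blast
      then have "x \<in> \<phi> ` carrier G" using \<open>\<And>k. k0 \<le> k \<Longrightarrow> Z k = {}\<close>[OF k] x y by (auto simp: Z_def)
      then show "y \<in> (\<phi> ^^ Suc k) ` carrier G" using x(2) by (auto simp: funpow_swap1)
    qed
    have "N \<inter> image_core k \<lhd> G" by (rule normal_subgroup_intersect[OF normal_N normal_image_core])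
    from normal_conj_closed[OF this] sub N.subset show ?thesis
      unfolding image_core_def[of "Suc k"] by blast
  qed
  have "N \<inter> image_core k0 \<subseteq> image_core k" if "k0 \<le> k" for k
    using that by (induction rule: dec_induct) (use step in auto)
  then have "N \<inter> image_core k0 \<subseteq> (\<phi> ^^ k) ` N" if "k0 \<le> k" for k
    using that image_core_subset[of k] unfolding iterate_image_N by blast
  then have triv: "N \<inter> image_core k0 \<subseteq> {\<one>}" using N_eq_one_of_eventually by blast
  \<comment> \<open>Contraction carries N by \<phi>^s into the open subgroup
    \<open>image_core k0\<close>, hence into the trivial intersection.\<close>
  obtain s where "\<And>j. s \<le> j \<Longrightarrow> (\<phi> ^^ j) ` N \<subseteq> image_core k0"
    using N_iterate_subset_open[OF openin_image_core]
      subgroup.one_closed[OF normal_imp_subgroup[OF normal_image_core]] by blast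
  then have s: "(\<phi> ^^ s) ` N \<subseteq> image_core k0" by blast
  obtain x where x: "x \<in> N" "x \<noteq> \<one>" by (rule nontrivial_element)
  have "(\<phi> ^^ s) x \<in> N \<inter> image_core k0" using s x(1) by auto
  then have "(\<phi> ^^ s) x = (\<phi> ^^ s) \<one>" using triv by auto
  then have "x = \<one>" by (rule iterate_eq_iff[THEN iffD1, rotated 2]) (use x in auto)
  then show False using x by blast
qed

lemma iterate_N_subset_persistent_core: obtains a where "(\<phi> ^^ a) ` N \<subseteq> persistent_core"
  using iterate_N_subset[OF normal_persistent_core closedin_persistent_core persistent_core_subset_N image_persistent_core_subset persistent_core_nontrivial] .

text \<open>An element of N in \<phi>^(a+1)(G) lies in \<phi>^(a+1)(N), hence in the image of
  \<open>persistent_core\<close>. So the cosets are no more numerous than those of the open subgroup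
  \<phi>^(a+1)(G).\<close>

lemma finite_cosets_image_persistent_core: "finite ((\<lambda>x. \<phi> ` persistent_core #> x) ` persistent_core)"
proof -
  obtain a where a: "(\<phi> ^^ a) ` N \<subseteq> persistent_core" by (rule iterate_N_subset_persistent_core)
  let ?H = "(\<phi> ^^ Suc a) ` carrier G"
  let ?f = "\<lambda>x. ?H #> x" and ?g = "\<lambda>x. \<phi> ` persistent_core #> x"
  have H: "subgroup ?H G" by (rule subgroup_iterate_carrier)
  have sgA: "subgroup (\<phi> ` persistent_core) G"
    using subgroup_iterate_image[of persistent_core 1] normal_imp_subgroup[OF normal_persistent_core] by simp
  have "?f ` persistent_core \<subseteq> rcosets ?H"
    using persistent_core_subset_carrier subgroup.subset[OF H] by (auto intro!: rcosetsI simp del: funpow.simps)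
  then have fin: "finite (?f ` persistent_core)"
    by (rule finite_subset[OF _ open_subgroup_finite_index[OF H openin_iterate_carrier]])
  have fg: "?g x = ?g y" if "x \<in> persistent_core" "y \<in> persistent_core" "?f x = ?f y" for x y
  proof -
    have xy: "x \<in> carrier G" "y \<in> carrier G" "x \<in> N" "y \<in> N"
      using that persistent_core_subset_carrier persistent_core_subset_N by auto
    have "x \<otimes> inv y \<in> ?H" using that(3) rcos_eq_iff[OF H xy(1,2)] by blast
    moreover have "x \<otimes> inv y \<in> N" using xy by auto
    ultimately have "x \<otimes> inv y \<in> (\<phi> ^^ Suc a) ` N" unfolding iterate_image_N by blast
    then have "x \<otimes> inv y \<in> \<phi> ` persistent_core" using a by auto
    then show ?thesis using rcos_eq_iff[OF sgA xy(1,2)] by blast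
  qed
  have "?g ` persistent_core \<subseteq> (\<lambda>b. ?g (inv_into persistent_core ?f b)) ` (?f ` persistent_core)"
  proof
    fix C assume "C \<in> ?g ` persistent_core"
    then obtain x where x: "x \<in> persistent_core" "C = ?g x" by blast
    then have "?f x \<in> ?f ` persistent_core" by blast
    then have "?g (inv_into persistent_core ?f (?f x)) = ?g x"
      using x(1) by (intro fg inv_into_into f_inv_into_f)
    then show "C \<in> (\<lambda>b. ?g (inv_into persistent_core ?f b)) ` (?f ` persistent_core)" using x by (metis image_eqI)
  qed
  then show ?thesis using fin finite_surj by blast
qed

definition persistent_core_index :: nat where
  "persistent_core_index = card ((\<lambda>x. \<phi> ` persistent_core #> x) ` persistent_core)"

lemma iterate_rcos: "H \<subseteq> carrier G \<Longrightarrow> x \<in> carrier G \<Longrightarrow> (\<phi> ^^ j) ` (H #> x) = (\<phi> ^^ j) ` H #> (\<phi> ^^ j) x"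
  unfolding r_coset_def UNION_singleton_eq_range image_image
  by (rule image_cong) (auto simp: subset_iff)

text \<open>The index of the centraliser of an element of \<open>(\<phi> ^^ j) ` persistent_core\<close> modulo
  \<open>(\<phi> ^^ Suc j) ` persistent_core\<close> is at most the length of its orbit, hence bounded independently of \<open>j\<close>.\<close>

lemma index_core_centralizes_persistent_core:
  assumes g: "g \<in> index_core persistent_core_index" and c: "c \<in> (\<phi> ^^ j) ` persistent_core"
  shows "commutator g c \<in> (\<phi> ^^ Suc j) ` persistent_core"
proof -
  let ?B = "(\<phi> ^^ Suc j) ` persistent_core"
  let ?S = "{g \<in> carrier G. commutator g c \<in> ?B}"
  have cG: "c \<in> carrier G" using c normal_imp_subgroup[OF normal_iterate_persistent_core] subgroup.mem_carrier by metis
  have B: "?B \<lhd> G" by (rule normal_iterate_persistent_core)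
  interpret B: normal ?B G by (rule B)
  have S: "subgroup ?S G" by (rule subgroup_commutator_preimage[OF B cG])
  have "closedin T ?S" unfolding commutator_def using cG
    by (intro closedin_carrier_preimage iterate_closed_image closedin_persistent_core group_continuous_intros
        continuous_map_group_id)
  \<comment> \<open>Conjugates of c modulo ?B: elements with equal values differ by an element of
    ?S, so the index of ?S is at most the number of values.\<close>
  let ?f = "\<lambda>g. ?B #> (inv g \<otimes> c \<otimes> g)"
  \<comment> \<open>Every value is the \<phi>^j-image of a coset in the first section, which is why
    the bound does not depend on j.\<close>
  have sub: "?f ` carrier G \<subseteq> (\<lambda>X. (\<phi> ^^ j) ` X) ` ((\<lambda>x. \<phi> ` persistent_core #> x) ` persistent_core)"
  proof
    fix X assume "X \<in> ?f ` carrier G"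
    then obtain g where g: "g \<in> carrier G" "X = ?f g" by blast
    have "inv g \<otimes> c \<otimes> g \<in> (\<phi> ^^ j) ` persistent_core"
      by (rule normal.inv_op_closed1[OF normal_iterate_persistent_core g(1) c])
    then obtain b where b: "b \<in> persistent_core" "inv g \<otimes> c \<otimes> g = (\<phi> ^^ j) b" by blast
    have "(\<phi> ^^ j) ` (\<phi> ` persistent_core #> b) = (\<phi> ^^ j) ` (\<phi> ` persistent_core) #> (\<phi> ^^ j) b"
      using b persistent_core_subset_carrier by (intro iterate_rcos) auto
    also have "(\<phi> ^^ j) ` (\<phi> ` persistent_core) = ?B" using iterate_image_add[of j 1 persistent_core] by simp
    finally have "X = (\<phi> ^^ j) ` (\<phi> ` persistent_core #> b)" using g b by simp
    then show "X \<in> (\<lambda>X. (\<phi> ^^ j) ` X) ` ((\<lambda>x. \<phi> ` persistent_core #> x) ` persistent_core)" using b by blast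
  qed
  have f1: "finite (?f ` carrier G)"
    by (rule finite_subset[OF sub]) (intro finite_imageI finite_cosets_image_persistent_core)
  have "card (?f ` carrier G) \<le> card ((\<lambda>X. (\<phi> ^^ j) ` X) ` ((\<lambda>x. \<phi> ` persistent_core #> x) ` persistent_core))"
    by (intro card_mono finite_imageI finite_cosets_image_persistent_core sub)
  also have "\<dots> \<le> persistent_core_index"
    unfolding persistent_core_index_def by (intro card_image_le finite_cosets_image_persistent_core)
  finally have f2: "card (?f ` carrier G) \<le> persistent_core_index" .
  have inj: "x \<otimes> inv y \<in> ?S" if xy: "x \<in> carrier G" "y \<in> carrier G" and eq: "?f x = ?f y" for x y
  proof -
    have "(inv x \<otimes> c \<otimes> x) \<otimes> inv (inv y \<otimes> c \<otimes> y) \<in> ?B"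
      using eq rcos_eq_iff[OF B.subgroup_axioms] xy cG by simp
    from B.inv_op_closed2[OF xy(2) this]
    have "y \<otimes> ((inv x \<otimes> c \<otimes> x) \<otimes> inv (inv y \<otimes> c \<otimes> y)) \<otimes> inv y \<in> ?B" .
    also have "y \<otimes> ((inv x \<otimes> c \<otimes> x) \<otimes> inv (inv y \<otimes> c \<otimes> y)) \<otimes> inv y = commutator (y \<otimes> inv x) c"
      using xy cG by (simp add: commutator_def inv_mult_group m_assoc)
    finally have "y \<otimes> inv x \<in> ?S" using xy by simp
    from subgroup.m_inv_closed[OF S this] show ?thesis using xy by (simp add: inv_mult_group)
  qed
  note index = card_rcosets_le[OF S f1 inj]
  have "open_subgroup ?S G T"
    unfolding open_subgroup_def
    using S closed_subgroup_finite_index_open[OF S \<open>closedin T ?S\<close> index(1)] by blast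
  from index_core_subset[OF this order_trans[OF index(2) f2]] show ?thesis using g by blast
qed

section \<open>Commutator bounds and commutativity of N\<close>

lemma iterate_persistent_core_cancel:
  assumes "y \<in> carrier G" "(\<phi> ^^ s) y \<in> (\<phi> ^^ (s + i)) ` persistent_core"
  shows "y \<in> (\<phi> ^^ i) ` persistent_core"
proof -
  obtain a where a: "a \<in> persistent_core" "(\<phi> ^^ s) y = (\<phi> ^^ s) ((\<phi> ^^ i) a)"
    using assms(2) by (auto simp: iterate_add)
  then have "y = (\<phi> ^^ i) a" using assms(1) persistent_core_subset_carrier by (auto simp: iterate_eq_iff)
  then show ?thesis using a by blast
qed

lemma iterate_commutator:
  "x \<in> carrier G \<Longrightarrow> y \<in> carrier G \<Longrightarrow>
    (\<phi> ^^ k) (commutator x y) = commutator ((\<phi> ^^ k) x) ((\<phi> ^^ k) y)"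
  by (simp add: commutator_def)

lemma iterate_persistent_core_subset_N: "(\<phi> ^^ j) ` persistent_core \<subseteq> N"
  using persistent_core_subset_N by auto

text \<open>Applying \<phi>^s moves x into \<phi>^s(N), where the bound is known, and raises both
  exponents by s; injectivity cancels \<phi>^s again.\<close>

lemma commutator_bound_shift:
  assumes bound: "\<And>j x a. x \<in> (\<phi> ^^ s) ` N \<Longrightarrow> a \<in> (\<phi> ^^ j) ` persistent_core \<Longrightarrow> commutator x a \<in> (\<phi> ^^ (j + m)) ` persistent_core"
    and x: "x \<in> N" and a: "a \<in> (\<phi> ^^ j) ` persistent_core"
  shows "commutator x a \<in> (\<phi> ^^ (j + m)) ` persistent_core"
proof (rule iterate_persistent_core_cancel)
  have aG: "a \<in> carrier G" using a iterate_persistent_core_subset_N N.subset by blast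
  show "commutator x a \<in> carrier G" using x aG by simp
  have "(\<phi> ^^ s) a \<in> (\<phi> ^^ (s + j)) ` persistent_core" using a by (auto simp: iterate_add)
  then have "commutator ((\<phi> ^^ s) x) ((\<phi> ^^ s) a) \<in> (\<phi> ^^ (s + j + m)) ` persistent_core"
    using x by (intro bound) auto
  then show "(\<phi> ^^ s) (commutator x a) \<in> (\<phi> ^^ (s + (j + m))) ` persistent_core"
    using x aG by (simp add: iterate_commutator add.assoc)
qed

text \<open>By contraction some \<phi>^s(N) lies in the open subgroup that centralises every
  section; shifting extends this to N.\<close>

lemma N_centralizes_persistent_core:
  assumes "x \<in> N" "a \<in> (\<phi> ^^ j) ` persistent_core"
  shows "commutator x a \<in> (\<phi> ^^ (j + 1)) ` persistent_core"
proof -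
  obtain s where "\<And>j. s \<le> j \<Longrightarrow> (\<phi> ^^ j) ` N \<subseteq> index_core persistent_core_index"
    using N_iterate_subset_open[OF openin_index_core subgroup.one_closed[OF subgroup_index_core]] by blast
  then have "(\<phi> ^^ s) ` N \<subseteq> index_core persistent_core_index" by blast
  then show ?thesis
    using index_core_centralizes_persistent_core by (intro commutator_bound_shift[OF _ assms, where s=s]) auto
qed

text \<open>The closed derived subgroup of N. Intersecting over subgroups normal in G builds
  normality in, and an inclusion is proved by exhibiting one admissible H.\<close>

definition derived :: "'a set" where
  "derived = \<Inter>{H. H \<lhd> G \<and> closedin T H \<and> (\<forall>x\<in>N. \<forall>y\<in>N. commutator x y \<in> H)}"

lemma commutator_in_N: "x \<in> N \<Longrightarrow> y \<in> N \<Longrightarrow> commutator x y \<in> N"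
  by (simp add: commutator_def)

lemma derived_subset:
  "H \<lhd> G \<Longrightarrow> closedin T H \<Longrightarrow> (\<And>x y. x \<in> N \<Longrightarrow> y \<in> N \<Longrightarrow> commutator x y \<in> H) \<Longrightarrow> derived \<subseteq> H"
  unfolding derived_def by (rule Inter_lower) blast

lemma derived_subset_N: "derived \<subseteq> N"
  by (intro derived_subset normal_N closed_N commutator_in_N)

lemma commutator_in_derived: "x \<in> N \<Longrightarrow> y \<in> N \<Longrightarrow> commutator x y \<in> derived"
  unfolding derived_def by blast

lemma derived_props: "derived \<lhd> G" "closedin T derived"
proof -
  have "N \<in> {H. H \<lhd> G \<and> closedin T H \<and> (\<forall>x\<in>N. \<forall>y\<in>N. commutator x y \<in> H)}"
    by (intro CollectI conjI ballI normal_N closed_N commutator_in_N)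
  then have ne: "{H. H \<lhd> G \<and> closedin T H \<and> (\<forall>x\<in>N. \<forall>y\<in>N. commutator x y \<in> H)} \<noteq> {}"
    by (metis (no_types) empty_iff)
  show "derived \<lhd> G" unfolding derived_def by (rule normal_Inter[OF ne]) (elim CollectE conjE)
  show "closedin T derived" unfolding derived_def by (rule closedin_Inter[OF ne]) (elim CollectE conjE)
qed

lemma image_derived_subset: "\<phi> ` derived \<subseteq> derived"
proof -
  have "derived \<subseteq> {x \<in> carrier G. (\<phi> ^^ 1) x \<in> derived}"
  proof (rule derived_subset)
    show "{x \<in> carrier G. (\<phi> ^^ 1) x \<in> derived} \<lhd> G"
      by (rule normal_preimage[OF derived_props(1)])
    show "closedin T {x \<in> carrier G. (\<phi> ^^ 1) x \<in> derived}"
      by (intro closedin_carrier_preimage iterate_continuous derived_props)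
    fix x y assume xy: "x \<in> N" "y \<in> N"
    then have "(\<phi> ^^ 1) (commutator x y) = commutator ((\<phi> ^^ 1) x) ((\<phi> ^^ 1) y)"
      by (intro iterate_commutator) auto
    also have "\<dots> \<in> derived" using xy by (intro commutator_in_derived iterate_in_N)
    finally show "commutator x y \<in> {x \<in> carrier G. (\<phi> ^^ 1) x \<in> derived}" using xy by simp
  qed
  then show ?thesis by auto
qed

text \<open>Gruen's lemma in disguise: if \<open>N\<close> moves \<open>(\<phi> ^^ j) ` persistent_core\<close> only within
  \<open>(\<phi> ^^ (j + k)) ` persistent_core\<close>, then \<open>x \<mapsto> commutator x a\<close> is a homomorphism into an abelian group modulo \<open>(\<phi> ^^ (j + Suc k)) ` persistent_core\<close>,
  and hence kills the closed derived subgroup.\<close>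

lemma derived_centralizes_persistent_core:
  assumes P: "\<And>j x a. x \<in> N \<Longrightarrow> a \<in> (\<phi> ^^ j) ` persistent_core \<Longrightarrow> commutator x a \<in> (\<phi> ^^ (j + k)) ` persistent_core"
    and x: "x \<in> derived" and a: "a \<in> (\<phi> ^^ j) ` persistent_core"
  shows "commutator x a \<in> (\<phi> ^^ (j + Suc k)) ` persistent_core"
proof -
  define B where "B = (\<phi> ^^ (j + Suc k)) ` persistent_core"
  let ?S = "\<lambda>a. {g \<in> carrier G. commutator g a \<in> B}"
  let ?H = "\<Inter>a\<in>(\<phi> ^^ j) ` persistent_core. ?S a"
  have aG: "a \<in> carrier G" if "a \<in> (\<phi> ^^ j) ` persistent_core" for a j using that iterate_persistent_core_subset_N N.subset by blast
  have B: "B \<lhd> G" unfolding B_def by (rule normal_iterate_persistent_core)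
  have clB: "closedin T B" unfolding B_def by (intro iterate_closed_image closedin_persistent_core)
  have ne: "(\<lambda>a. ?S a) ` (\<phi> ^^ j) ` persistent_core \<noteq> {}" using a by blast
  have "derived \<subseteq> ?H"
  proof (rule derived_subset)
    show "?H \<lhd> G"
    proof (rule normalI_conj)
      show "subgroup ?H G"
      proof (rule subgroups_Inter[OF _ ne])
        fix S assume "S \<in> (\<lambda>a. ?S a) ` (\<phi> ^^ j) ` persistent_core"
        then obtain a where a: "a \<in> (\<phi> ^^ j) ` persistent_core" "S = ?S a" by blast
        show "subgroup S G"
          unfolding a(2) by (rule subgroup_commutator_preimage[OF B aG[OF a(1)]])
      qed
      fix g x assume g: "g \<in> carrier G" and x: "x \<in> ?H"
      have xG: "x \<in> carrier G" using INT_D[OF x a] by simp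
      have "commutator (g \<otimes> x \<otimes> inv g) a \<in> B" if a: "a \<in> (\<phi> ^^ j) ` persistent_core" for a
      proof -
        have "inv g \<otimes> a \<otimes> g \<in> (\<phi> ^^ j) ` persistent_core"
          by (rule normal.inv_op_closed1[OF normal_iterate_persistent_core g a])
        then have "x \<in> ?S (inv g \<otimes> a \<otimes> g)" using x by (rule INT_D[rotated])
        then have "commutator x (inv g \<otimes> a \<otimes> g) \<in> B" by simp
        from normal_conj_closed[OF B g this] show ?thesis
          using commutator_conj[OF g xG aG[OF a]] by simp
      qed
      then show "g \<otimes> x \<otimes> inv g \<in> ?H" using g xG by simp
    qed
    show "closedin T ?H"
    proof (rule closedin_Inter[OF ne])
      fix S assume "S \<in> (\<lambda>a. ?S a) ` (\<phi> ^^ j) ` persistent_core"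
      then obtain a where a: "a \<in> (\<phi> ^^ j) ` persistent_core" "S = ?S a" by blast
      show "closedin T S" unfolding a(2) commutator_def using aG[OF a(1)]
        by (intro closedin_carrier_preimage clB group_continuous_intros continuous_map_group_id)
    qed
    fix x y assume xy: "x \<in> N" "y \<in> N"
    have "commutator x y \<in> ?S a" if a: "a \<in> (\<phi> ^^ j) ` persistent_core" for a
    proof -
      \<comment> \<open>\<open>commutator_centralizes_mod\<close> concludes about a commutator of
        inverses, so it is applied to \<open>inv x\<close> and \<open>inv y\<close>.\<close>
      have ixy: "inv x \<in> N" "inv y \<in> N" using xy by auto
      have u: "commutator (inv x) a \<in> (\<phi> ^^ (j + k)) ` persistent_core" "commutator (inv y) a \<in> (\<phi> ^^ (j + k)) ` persistent_core"
        using P ixy a by auto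
      \<comment> \<open>This supplies all three hypotheses; for the last one, the commutators with a
        are themselves elements of N.\<close>
      have "commutator z w \<in> B" if "z \<in> N" "w \<in> (\<phi> ^^ (j + k)) ` persistent_core" for z w
        using N_centralizes_persistent_core[OF that] by (simp only: B_def add.assoc Suc_eq_plus1)
      then have "commutator (commutator (inv (inv x)) (inv (inv y))) a \<in> B"
        using u ixy iterate_persistent_core_subset_N[of "j + k"]
        by (intro commutator_centralizes_mod[OF B _ _ aG[OF a]]) (blast intro: N.mem_carrier)+
      then show ?thesis using xy by simp
    qed
    then show "commutator x y \<in> ?H" by blast
  qed
  then have "x \<in> ?H" using x by blast
  from INT_D[OF this a] show ?thesis by (simp add: B_def)
qed

lemma N_abelian:
  assumes "x \<in> N" "y \<in> N" shows "x \<otimes> y = y \<otimes> x"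
proof (cases "derived = {\<one>}")
  case True
  then show ?thesis
    using commutator_in_derived[OF assms] commutator_eq_one_iff assms by auto
next
  case False
  then obtain s where s: "(\<phi> ^^ s) ` N \<subseteq> derived"
    using iterate_N_subset[OF derived_props derived_subset_N image_derived_subset] by blast
  have P: "commutator x a \<in> (\<phi> ^^ (j + k)) ` persistent_core" if "x \<in> N" "a \<in> (\<phi> ^^ j) ` persistent_core" for j k x a
    using that
  proof (induction k arbitrary: j x a)
    case 0
    then show ?case using commutator_in_normal[OF normal_iterate_persistent_core] by simp
  next
    case (Suc k)
    show ?case
    \<comment> \<open>The bound improves by one on \<open>derived\<close>, which contains
      \<phi>^s(N), and shifting restores it on all of N.\<close>
    proof (rule commutator_bound_shift[OF _ Suc.prems])
      fix j x a assume "x \<in> (\<phi> ^^ s) ` N" "a \<in> (\<phi> ^^ j) ` persistent_core"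
      then show "commutator x a \<in> (\<phi> ^^ (j + Suc k)) ` persistent_core"
        using derived_centralizes_persistent_core[OF Suc.IH] s by blast
    qed
  qed
  have centr: "commutator x a = \<one>" if "x \<in> N" "a \<in> persistent_core" for x a
  proof (rule N_iterate_eq_one)
    fix k
    have "commutator x a \<in> (\<phi> ^^ (0 + k)) ` persistent_core" by (rule P) (use that in auto)
    then show "commutator x a \<in> (\<phi> ^^ k) ` N" using persistent_core_subset_N by auto
  qed
  obtain a where a: "(\<phi> ^^ a) ` N \<subseteq> persistent_core" by (rule iterate_N_subset_persistent_core)
  \<comment> \<open>\<phi>^a(y) lies in \<open>persistent_core\<close>, which N centralises;
    injectivity of \<phi>^a then returns to x and y.\<close>
  have "commutator ((\<phi> ^^ a) x) ((\<phi> ^^ a) y) = \<one>" using a assms by (intro centr) auto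
  then have "(\<phi> ^^ a) (commutator x y) = (\<phi> ^^ a) \<one>" using assms by (simp add: iterate_commutator)
  then have "commutator x y = \<one>" using assms by (simp only: iterate_eq_iff commutator_closed N.mem_carrier one_closed)
  then show ?thesis using assms commutator_eq_one_iff by auto
qed

end

section \<open>Sylow subgroups\<close>

lemma prime_power_if_unique_prime_divisor:
  fixes n p :: nat
  assumes p: "Factorial_Ring.prime p" and "n > 0"
    and q: "\<And>q. Factorial_Ring.prime q \<Longrightarrow> q dvd n \<Longrightarrow> q = p"
  shows "\<exists>k. n = p ^ k"
proof -
  have "n \<noteq> 0" "\<not> is_unit p" using assms by auto
  then obtain m where m: "n = p ^ multiplicity p n * m" "\<not> p dvd m"
    by (rule multiplicity_decompose')
  have "m = 1"
  proof (rule ccontr)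
    assume "m \<noteq> 1"
    then obtain r where r: "Factorial_Ring.prime r" "r dvd m" using prime_factor_nat by blast
    then have "r dvd n" by (subst m(1)) (rule dvd_mult)
    then have "r = p" using q r by blast
    then show False using m r by blast
  qed
  then show ?thesis using m(1) by auto
qed

context group
begin

lemma ord_of_prime_power:
  assumes "x \<in> carrier G" "Factorial_Ring.prime p" "x [^] (p ^ i :: nat) = \<one>"
  obtains j where "ord x = p ^ j"
  using assms pow_eq_id[of x "p ^ i"] divides_primepow_nat[of p "ord x" i] by auto

text \<open>A prime q dividing the order gives a subgroup of order q by Sylow's theorem, hence an
  element of order q, and the torsion hypothesis forces q = p.\<close>

lemma order_prime_power:
  assumes fin: "finite (carrier G)" and p: "Factorial_Ring.prime p"
    and tors: "\<And>x. x \<in> carrier G \<Longrightarrow> \<exists>i. x [^] (p ^ i :: nat) = \<one>"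
  shows "\<exists>k. order G = p ^ k"
proof (rule prime_power_if_unique_prime_divisor[OF p])
  show "order G > 0" using fin order_gt_0_iff_finite by blast
  fix q assume q: "Factorial_Ring.prime q" "q dvd order G"
  then obtain m where m: "order G = q ^ 1 * m" by auto
  then obtain H where H: "subgroup H G" "card H = q"
    using sylow.sylow_thm[of G q 1 m] q fin is_group
    by (auto simp: sylow_eq sylow_axioms_def)
  have "card H \<noteq> 1" "card H \<noteq> 0" using H q(1) by auto
  then have "\<not> H \<subseteq> {\<one>}" using card_mono[of "{\<one>}" H] by auto
  then obtain x where x: "x \<in> H" "x \<noteq> \<one>" by blast
  have xG: "x \<in> carrier G" using H x subgroup.mem_carrier by metis
  interpret H: group "G\<lparr>carrier := H\<rparr>" using H(1) by (rule subgroup_imp_group)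
  have "x [^]\<^bsub>G\<lparr>carrier := H\<rparr>\<^esub> order (G\<lparr>carrier := H\<rparr>) = \<one>\<^bsub>G\<lparr>carrier := H\<rparr>\<^esub>"
    using x by (intro H.pow_order_eq_1) auto
  then have "x [^] q = \<one>" using H(2) by (simp add: order_def nat_pow_consistent[symmetric])
  then have "ord x dvd q" using pow_eq_id[OF xG] by blast
  moreover have "ord x \<noteq> 1" using ord_eq_1[OF xG] x by simp
  ultimately have oq: "ord x = q" using q(1) prime_nat_iff by blast
  obtain i where "x [^] (p ^ i) = \<one>" using tors[OF xG] by blast
  then have "q dvd p ^ i" using oq pow_eq_id[OF xG] by blast
  then show "q = p" using p q(1) prime_dvd_power primes_dvd_imp_eq by blast
qed

text \<open>The coset of x has order p^j with j < p^j, and p^j is at most the index; so the index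
  itself is a sufficient exponent of p, uniformly in x.\<close>

lemma prime_power_exponent_bound:
  assumes H: "H \<lhd> G" "finite (rcosets H)" and p: "Factorial_Ring.prime p"
    and x: "x \<in> carrier G" "x [^] (p ^ i :: nat) \<in> H"
  shows "x [^] (p ^ card (rcosets H)) \<in> H"
proof -
  interpret H: normal H G by (rule H)
  interpret Q: group "G Mod H" by (rule H.factorgroup_is_group)
  have fin: "finite (carrier (G Mod H))" using H(2) by (simp add: FactGroup_def)
  have xQ: "H #> x \<in> carrier (G Mod H)" using x by (auto simp: carrier_FactGroup)
  have iff: "(H #> x) [^]\<^bsub>G Mod H\<^esub> n = \<one>\<^bsub>G Mod H\<^esub> \<longleftrightarrow> x [^] n \<in> H" for n :: nat
    unfolding H.FactGroup_pow[OF x(1)] one_FactGroup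
    using coset_join1[OF _ nat_pow_closed[OF x(1)] H.subgroup_axioms]
      coset_join2[OF nat_pow_closed[OF x(1)] H.subgroup_axioms] by blast
  obtain j where j: "Q.ord (H #> x) = p ^ j"
    using Q.ord_of_prime_power[OF xQ p] x(2) iff by blast
  have "j < p ^ j" using prime_gt_1_nat[OF p] by (simp add: power_gt_expt)
  also have "p ^ j \<le> order (G Mod H)" using Q.ord_le_group_order[OF fin xQ] j by simp
  also have "order (G Mod H) = card (rcosets H)" by (simp add: order_def FactGroup_def)
  finally have "p ^ j dvd p ^ card (rcosets H)" by (intro le_imp_power_dvd) simp
  then show ?thesis using Q.pow_eq_id[OF xQ] j iff by metis
qed

lemma mem_subgroup_if_coprime_powers:
  assumes H: "subgroup H G" and x: "x \<in> carrier G" "x [^] (m::nat) \<in> H" "x [^] (n::nat) \<in> H"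
    and "coprime m n" "m \<noteq> 0"
  shows "x \<in> H"
proof -
  interpret H: subgroup H G by (rule H)
  obtain a b where ab: "m * a = n * b + 1"
    using bezout_nat[OF \<open>m \<noteq> 0\<close>, of n] \<open>coprime m n\<close> by auto
  have pw: "y [^] k \<in> H" if "y \<in> H" for y and k :: nat using that by (induction k) auto
  have "x [^] (m * a) \<in> H" "x [^] (n * b) \<in> H"
    using pw[OF x(2), of a] pw[OF x(3), of b] x(1) by (simp_all add: nat_pow_pow)
  moreover have "x [^] (m * a) = x [^] (n * b) \<otimes> x" using ab by simp
  then have "x = inv (x [^] (n * b)) \<otimes> x [^] (m * a)" using x(1) by (simp flip: m_assoc)
  ultimately show ?thesis using H.m_closed H.m_inv_closed by metis
qed

lemma conj_nat_pow:
  assumes "g \<in> carrier G" "x \<in> carrier G"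
  shows "(g \<otimes> x \<otimes> inv g) [^] (n::nat) = g \<otimes> x [^] n \<otimes> inv g"
proof (induction n)
  case (Suc n)
  have "inv g \<otimes> (g \<otimes> z) = z" if "z \<in> carrier G" for z
    using that assms by (simp flip: m_assoc)
  then show ?case using Suc assms by (simp add: m_assoc)
qed (use assms in simp)

end

section \<open>Closed subgroups as profinite groups\<close>

lemma (in topological_group) topological_group_subgroup:
  assumes "subgroup S G"
  shows "topological_group (G\<lparr>carrier := S\<rparr>) (subtopology T S)"
proof -
  interpret S: subgroup S G by fact
  interpret GS: group "G\<lparr>carrier := S\<rparr>" using assms by (rule subgroup_imp_group)
  have top: "topspace (subtopology T S) = S" using S.subset by (auto simp: topspace_eq)
  show ?thesis
  proof
    show "topspace (subtopology T S) = carrier (G\<lparr>carrier := S\<rparr>)" using top by simp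
    have "continuous_map (subtopology (prod_topology T T) (S \<times> S)) (subtopology T S) (\<lambda>(x, y). x \<otimes> y)"
      by (intro continuous_map_into_subtopology continuous_map_from_subtopology continuous_mult) auto
    then show "continuous_map (prod_topology (subtopology T S) (subtopology T S)) (subtopology T S)
        (\<lambda>(x, y). x \<otimes>\<^bsub>G\<lparr>carrier := S\<rparr>\<^esub> y)"
      by (simp add: subtopology_Times)
    have "continuous_map (subtopology T S) (subtopology T S) (\<lambda>x. inv x)"
      by (intro continuous_map_into_subtopology continuous_map_from_subtopology continuous_inv) auto
    then show "continuous_map (subtopology T S) (subtopology T S) (\<lambda>x. inv\<^bsub>G\<lparr>carrier := S\<rparr>\<^esub> x)"
      by (rule continuous_map_eq) (use top assms in simp)
  qed
qed

lemma totally_disconnected_subtopology: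
  assumes "totally_disconnected_space T"
  shows "totally_disconnected_space (subtopology T S)"
  unfolding totally_disconnected_space_def
proof
  fix x assume x: "x \<in> topspace (subtopology T S)"
  then have "connected_component_of_set T x = {x}"
    using assms by (simp add: totally_disconnected_space_def)
  moreover have "connected_component_of_set (subtopology T S) x \<subseteq> connected_component_of_set T x"
    by (auto simp: connected_component_of_def connectedin_subtopology)
  ultimately show "connected_component_of_set (subtopology T S) x = {x}"
    using x connected_component_of_refl[of "subtopology T S" x] by auto
qed

lemma (in profinite_group) profinite_group_subgroup:
  assumes "subgroup S G" "closedin T S"
  shows "profinite_group (G\<lparr>carrier := S\<rparr>) (subtopology T S)"
proof -
  interpret S: topological_group "G\<lparr>carrier := S\<rparr>" "subtopology T S"
    using assms(1) by (rule topological_group_subgroup)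
  show ?thesis
  proof
    show "compact_space (subtopology T S)"
      using assms(2) compact by (intro compact_space_subtopology closedin_compact_space)
    show "Hausdorff_space (subtopology T S)" using Hausdorff by (rule Hausdorff_space_subtopology)
    show "totally_disconnected_space (subtopology T S)"
      using totally_disconnected by (rule totally_disconnected_subtopology)
  qed
qed

section \<open>The Sylow subgroups of the abelian group N\<close>

context minimal_stable
begin

text \<open>The exponent bounds the order of every element of \<open>p\<close>-power order modulo \<open>index_core n\<close>;
  a common exponent for all elements makes closure under multiplication and closedness immediate.\<close>

definition p_part :: "nat \<Rightarrow> 'a set" where
  "p_part p = {x \<in> N. \<forall>n. x [^] (p ^ card (rcosets (index_core n))) \<in> index_core n}"

lemma finite_rcosets_index_core: "finite (rcosets (index_core n))"
  by (intro open_subgroup_finite_index subgroup_index_core openin_index_core)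

lemma subgroup_p_part: "subgroup (p_part p) G"
proof
  interpret I: normal "index_core n" G for n by (rule normal_index_core)
  show "p_part p \<subseteq> carrier G" using N.subset by (auto simp: p_part_def)
  show "\<one> \<in> p_part p" by (simp add: p_part_def)
  show "x \<otimes> y \<in> p_part p" if "x \<in> p_part p" "y \<in> p_part p" for x y
    using that N_abelian[of x y] by (simp add: p_part_def pow_mult_distrib)
  show "inv x \<in> p_part p" if "x \<in> p_part p" for x
    using that by (simp add: p_part_def nat_pow_inv)
qed

lemma normal_p_part: "p_part p \<lhd> G"
proof (rule normalI_conj[OF subgroup_p_part])
  fix g x assume g: "g \<in> carrier G" and x: "x \<in> p_part p"
  then have "x \<in> N" "x \<in> carrier G" by (auto simp: p_part_def)
  with x show "g \<otimes> x \<otimes> inv g \<in> p_part p"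
    using normal_conj_closed[OF normal_N g] normal_conj_closed[OF normal_index_core g]
    by (simp add: p_part_def conj_nat_pow[OF g])
qed

lemma closedin_pow_preimage:
  "closedin T {x \<in> carrier G. x [^] (m::nat) \<in> index_core n}"
  by (intro closedin_carrier_preimage closedin_index_core continuous_map_group_pow continuous_map_group_id)

lemma closedin_p_part: "closedin T (p_part p)"
proof -
  have "p_part p = N \<inter> (\<Inter>n. {x \<in> carrier G. x [^] (p ^ card (rcosets (index_core n))) \<in> index_core n})"
    using N.subset by (auto simp: p_part_def)
  then show ?thesis
    by (simp only:) (intro closedin_Int closed_N closedin_Inter, auto intro: closedin_pow_preimage)
qed

lemma image_p_part: "\<phi> ` p_part p \<subseteq> p_part p"
proof
  fix y assume "y \<in> \<phi> ` p_part p"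
  then obtain x where x: "x \<in> p_part p" "y = \<phi> x" by blast
  have xN: "x \<in> N" using x by (simp add: p_part_def)
  have "\<phi> x [^] m \<in> index_core n" if "x [^] m \<in> index_core n" for m n :: nat
  proof -
    have "\<phi> x [^] m = (\<phi> ^^ 1) (x [^] m)" using xN by (simp add: \<phi>.hom_nat_pow)
    then show ?thesis using iterate_index_core[OF that, of 1] by simp
  qed
  then show "y \<in> p_part p"
    using x xN iterate_in_N[OF xN, of 1] by (simp add: p_part_def)
qed

text \<open>On a finite set the injection \<phi> would be a permutation, so every element would lie
  in all \<phi>^k(N) and contraction would make it trivial.\<close>

lemma infinite_p_part:
  assumes "p_part p \<noteq> {\<one>}" shows "infinite (p_part p)"
proof
  assume fin: "finite (p_part p)"
  have sub: "p_part p \<subseteq> N" by (auto simp: p_part_def)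
  then have "inj_on \<phi> (p_part p)" using inj N.subset by (meson inj_on_subset order_trans)
  then have eq: "\<phi> ` p_part p = p_part p"
    using fin image_p_part by (intro card_subset_eq) (auto simp: card_image)
  have "(\<phi> ^^ k) ` p_part p = p_part p" for k
  proof (induction k)
    case (Suc k)
    have "(\<phi> ^^ Suc k) ` p_part p = \<phi> ` ((\<phi> ^^ k) ` p_part p)" by (simp add: image_comp)
    then show ?case using Suc eq by simp
  qed simp
  then have "x = \<one>" if "x \<in> p_part p" for x
    using that sub by (intro N_iterate_eq_one) blast
  then show False using assms subgroup.one_closed[OF subgroup_p_part] by blast
qed

lemma pro_p_p_part:
  assumes p: "Factorial_Ring.prime p"
  shows "pro_p_group p (G\<lparr>carrier := p_part p\<rparr>) (subtopology T (p_part p))"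
proof -
  let ?S = "p_part p"
  let ?GS = "G\<lparr>carrier := ?S\<rparr>"
  interpret S: profinite_group ?GS "subtopology T ?S"
    by (intro profinite_group_subgroup subgroup_p_part closedin_p_part)
  have "\<exists>k. card (rcosets\<^bsub>?GS\<^esub> M) = p ^ k" if M: "M \<lhd> ?GS" "openin (subtopology T ?S) M" for M
  proof -
    interpret M: normal M ?GS by (rule M)
    interpret Q: group "?GS Mod M" by (rule M.factorgroup_is_group)
    have fin: "finite (rcosets\<^bsub>?GS\<^esub> M)"
      by (intro S.open_subgroup_finite_index M.subgroup_axioms M(2))
    \<comment> \<open>M contains the intersection of \<open>p_part p\<close> with some
      \<open>index_core n\<close>, so the exponent attached to n annihilates the quotient.\<close>
    obtain U where U: "openin T U" "M = U \<inter> ?S" using M(2) by (auto simp: openin_subtopology)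
    have "\<one> \<in> U" using M.one_closed U by simp
    then obtain n where n: "index_core n \<subseteq> U" using index_core_neighbourhood U by blast
    let ?m = "p ^ card (rcosets (index_core n))"
    have "X [^]\<^bsub>?GS Mod M\<^esub> ?m = \<one>\<^bsub>?GS Mod M\<^esub>" if X: "X \<in> carrier (?GS Mod M)" for X
    proof -
      obtain x where x: "x \<in> ?S" "X = M #>\<^bsub>?GS\<^esub> x"
        using X unfolding carrier_FactGroup by auto
      have xS: "x \<in> carrier ?GS" using x by simp
      have "x [^]\<^bsub>?GS\<^esub> ?m \<in> ?S" using S.nat_pow_closed[OF xS, of ?m] by simp
      moreover have "x [^]\<^bsub>?GS\<^esub> ?m \<in> index_core n"
        using x(1) by (simp add: p_part_def nat_pow_consistent[symmetric])
      ultimately have "x [^]\<^bsub>?GS\<^esub> ?m \<in> M" using n U by blast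
      then have "M #>\<^bsub>?GS\<^esub> (x [^]\<^bsub>?GS\<^esub> ?m) = M"
        by (rule M.rcos_const[OF S.is_group])
      then show ?thesis unfolding x(2) M.FactGroup_pow[OF xS] one_FactGroup .
    qed
    then have "\<exists>k. order (?GS Mod M) = p ^ k"
      using fin by (intro Q.order_prime_power[OF _ p]) (auto simp: FactGroup_def)
    then show ?thesis by (simp add: order_def FactGroup_def)
  qed
  then show ?thesis using S.profinite_group_axioms unfolding pro_p_group_def
    by (auto intro: S.profinite_group_axioms)
qed

text \<open>If N meets m cosets of \<phi>(G), two of x^0, ..., x^m share a coset. So x^d lies in
  \<phi>(G) for some positive d up to m, and d divides m!, an exponent independent of x.\<close>

lemma pow_in_image:
  obtains c where "c > 0" "\<And>x. x \<in> N \<Longrightarrow> x [^] (c::nat) \<in> \<phi> ` N"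
proof -
  let ?m = "card (image_coset ` N)"
  have fin: "finite (image_coset ` N)" by (rule finite_image_cosets[OF N.subset])
  have "x [^] (fact ?m :: nat) \<in> \<phi> ` N" if x: "x \<in> N" for x
  proof -
    have xG: "x \<in> carrier G" using x by simp
    have pN: "x [^] k \<in> N" for k :: nat using x by (induction k) auto
    have "(\<lambda>i. image_coset (x [^] i)) ` {..?m} \<subseteq> image_coset ` N" using pN by blast
    then have "card ((\<lambda>i. image_coset (x [^] i)) ` {..?m}) \<le> ?m" by (rule card_mono[OF fin])
    then have "\<not> inj_on (\<lambda>i. image_coset (x [^] i)) {..?m}" by (intro pigeonhole) simp
    then obtain i j where ij: "i < j" "j \<le> ?m" "image_coset (x [^] i) = image_coset (x [^] j)"
      unfolding inj_on_def by (metis atMost_iff linorder_less_linear)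
    have "x [^] j \<otimes> inv (x [^] i) \<in> \<phi> ` carrier G"
      using ij(3) xG rcos_eq_iff[OF subgroup_image_carrier] by (metis nat_pow_closed)
    moreover have "x [^] j = x [^] (j - i) \<otimes> x [^] i" using ij xG by (simp add: nat_pow_mult)
    ultimately have "x [^] (j - i) \<in> \<phi> ` carrier G" using xG by (simp add: m_assoc)
    moreover have "(j - i) dvd fact ?m" using ij by (intro dvd_fact) auto
    ultimately have "x [^] (fact ?m :: nat) \<in> \<phi> ` carrier G"
    proof -
      assume a: "x [^] (j - i) \<in> \<phi> ` carrier G" and "(j - i) dvd fact ?m"
      then obtain d where d: "fact ?m = (j - i) * d" by blast
      interpret im: subgroup "\<phi> ` carrier G" G by (rule subgroup_image_carrier)
      have "(x [^] (j - i)) [^] d \<in> \<phi> ` carrier G" using a by (induction d) auto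
      then show ?thesis using xG by (simp add: d nat_pow_pow)
    qed
    then show ?thesis using pN iterate_image_N[of 1] by auto
  qed
  then show thesis using that[of "fact ?m"] by simp
qed

lemma pow_in_iterate_image:
  assumes "\<And>x. x \<in> N \<Longrightarrow> x [^] (c::nat) \<in> \<phi> ` N" "x \<in> N"
  shows "x [^] (c ^ k) \<in> (\<phi> ^^ k) ` N"
proof (induction k)
  case 0
  then show ?case using assms(2) by simp
next
  case (Suc k)
  then obtain y where y: "y \<in> N" "x [^] (c ^ k) = (\<phi> ^^ k) y" by blast
  obtain z where z: "z \<in> N" "y [^] c = \<phi> z" using assms(1)[OF y(1)] by blast
  have "x [^] (c ^ Suc k) = (x [^] (c ^ k)) [^] c"
    using assms(2) by (simp add: nat_pow_pow mult.commute)
  also have "\<dots> = (\<phi> ^^ k) (y [^] c)" using y by (simp add: it.hom_nat_pow)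
  also have "\<dots> = (\<phi> ^^ Suc k) z" by (simp add: z funpow_swap1)
  finally show ?case using z(1) by blast
qed

text \<open>Some z in N lies outside \<phi>(G) while z^p lies inside. Powers of z with exponent
  prime to p stay outside, and compactness extracts from them an element of \<open>p_part p\<close>
  outside \<phi>(G).\<close>

lemma p_part_nontrivial:
  obtains p where "Factorial_Ring.prime p" "p_part p \<noteq> {\<one>}"
proof -
  interpret im: subgroup "\<phi> ` carrier G" G by (rule subgroup_image_carrier)
  have pN: "x [^] k \<in> N" if "x \<in> N" for x and k :: nat using that by (induction k) auto
  obtain c :: nat where c: "c > 0" "\<And>x. x \<in> N \<Longrightarrow> x [^] c \<in> \<phi> ` N" by (rule pow_in_image) blast
  have "\<not> N \<subseteq> \<phi> ` carrier G"
  proof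
    assume "N \<subseteq> \<phi> ` carrier G"
    then have 1: "\<phi> ` N = N" using iterate_image_N[of 1] by auto
    have "(\<phi> ^^ k) ` N = N" for k
    proof (induction k)
      case (Suc k)
      have "(\<phi> ^^ Suc k) ` N = \<phi> ` ((\<phi> ^^ k) ` N)" by (simp add: image_comp)
      then show ?case using Suc 1 by simp
    qed simp
    then have "x = \<one>" if "x \<in> N" for x using that by (intro N_iterate_eq_one) simp
    then show False using nontrivial_element by metis
  qed
  then obtain x where x: "x \<in> N" "x \<notin> \<phi> ` carrier G" by blast
  have xG: "x \<in> carrier G" using x by simp
  \<comment> \<open>r is the order of x modulo \<phi>(G); for a prime p dividing it, z will be
    x^(r/p).\<close>
  define r where "r = (LEAST r::nat. r > 0 \<and> x [^] r \<in> \<phi> ` carrier G)"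
  have ex: "c > 0 \<and> x [^] c \<in> \<phi> ` carrier G" using c x N.subset by blast
  have r: "r > 0" "x [^] r \<in> \<phi> ` carrier G"
    using LeastI[of "\<lambda>r. r > 0 \<and> x [^] r \<in> \<phi> ` carrier G", OF ex] by (simp_all add: r_def)
  have least: "r \<le> s" if "s > 0" "x [^] s \<in> \<phi> ` carrier G" for s
    unfolding r_def using that by (intro Least_le) simp
  have "r \<noteq> 1" using r x xG by auto
  then obtain p where p: "Factorial_Ring.prime p" "p dvd r" using prime_factor_nat by blast
  then obtain s where s: "r = p * s" by blast
  have sp: "s > 0" "s < r" using s r prime_gt_1_nat[OF p(1)] by auto
  define z where "z = x [^] s"
  have zN: "z \<in> N" and zG: "z \<in> carrier G" using x(1) pN xG by (simp_all add: z_def)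
  have znot: "z \<notin> \<phi> ` carrier G" using least[of s] sp by (auto simp: z_def)
  have zp: "z [^] p \<in> \<phi> ` carrier G" using r(2) xG by (simp add: z_def nat_pow_pow s mult.commute)
  have "c \<noteq> 0" "\<not> is_unit p" using c p by auto
  then obtain u where u: "c = p ^ multiplicity p c * u" "\<not> p dvd u"
    by (rule multiplicity_decompose')
  let ?e = "multiplicity p c"
  have cop: "coprime (u ^ k) p" for k
    using prime_imp_coprime[OF p(1) u(2)] by (simp add: coprime_commute)
  have "u \<noteq> 0" using u(2) by (metis dvd_0_right)
  have wnot: "z [^] (u ^ k) \<notin> \<phi> ` carrier G" for k
    using mem_subgroup_if_coprime_powers[OF subgroup_image_carrier zG _ zp cop] znot \<open>u \<noteq> 0\<close>
    by (metis power_not_zero)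
  define Y where "Y n = N \<inter> {x \<in> carrier G. x [^] (p ^ card (rcosets (index_core n))) \<in> index_core n}
    - \<phi> ` carrier G" for n
  have "Y n \<noteq> {}" for n
  proof -
    obtain k where "\<And>j. k \<le> j \<Longrightarrow> (\<phi> ^^ j) ` N \<subseteq> index_core n"
      using N_iterate_subset_open[OF openin_index_core subgroup.one_closed[OF subgroup_index_core]] by blast
    then have k: "(\<phi> ^^ k) ` N \<subseteq> index_core n" by blast
    let ?w = "z [^] (u ^ k)"
    have "u ^ k * p ^ (?e * k) = c ^ k"
      using arg_cong[OF u(1), of "\<lambda>c. c ^ k"] unfolding power_mult_distrib power_mult
      by (simp only: mult.commute)
    then have "?w [^] (p ^ (?e * k)) = z [^] (c ^ k)" using zG by (simp add: nat_pow_pow)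
    also have "\<dots> \<in> (\<phi> ^^ k) ` N" by (rule pow_in_iterate_image[OF c(2) zN])
    finally have "?w [^] (p ^ (?e * k)) \<in> index_core n" using k by blast
    then have "?w [^] (p ^ card (rcosets (index_core n))) \<in> index_core n"
      using zG by (intro prime_power_exponent_bound[OF normal_index_core finite_rcosets_index_core p(1)]) auto
    then have "?w \<in> Y n" using wnot pN[OF zN] zG by (simp add: Y_def)
    then show ?thesis by blast
  qed
  moreover have "closedin T (Y n)" for n unfolding Y_def
    by (intro closedin_diff closedin_Int closed_N closedin_pow_preimage open_image)
  moreover have "decseq Y"
  proof (rule decseq_SucI)
    fix n
    show "Y (Suc n) \<subseteq> Y n"
    proof
      fix y assume y: "y \<in> Y (Suc n)"
      then have "y [^] (p ^ card (rcosets (index_core (Suc n)))) \<in> index_core n"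
        using index_core_antimono[of n "Suc n"] by (auto simp: Y_def)
      \<comment> \<open>The exponent depends on n, so membership obtained with the exponent for
        \<open>Suc n\<close> has to be converted to the one for n.\<close>
      then have "y [^] (p ^ card (rcosets (index_core n))) \<in> index_core n"
        using y by (intro prime_power_exponent_bound[OF normal_index_core finite_rcosets_index_core p(1)])
          (auto simp: Y_def)
      then show "y \<in> Y n" using y by (simp add: Y_def)
    qed
  qed
  ultimately have "(\<Inter>n. Y n) \<noteq> {}" using compact_space_imp_nest[OF compact, of Y] by blast
  then obtain y where y: "\<And>n. y \<in> Y n" by blast
  have "y \<in> p_part p" "y \<noteq> \<one>" using y im.one_closed by (auto simp: p_part_def Y_def)
  then show thesis using that p(1) by blast
qed

end

section \<open>From an isomorphism with an open subgroup to the pro-p subgroup\<close>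

theorem corollary1p4:
  fixes G :: "('a, 'b) monoid_scheme" and T :: "'a topology"
  assumes "profinite_group G T"
    and "type_F G T"
    and "\<exists>H. open_subgroup H G T \<and> H \<noteq> carrier G \<and>
           topological_group_isomorphic (G\<lparr>carrier := H\<rparr>) (subtopology T H) G T"
  shows "\<exists>p N. Factorial_Ring.prime (p::nat) \<and> N \<lhd> G \<and> infinite N \<and> comm_group (G\<lparr>carrier := N\<rparr>) \<and>
           pro_p_group p (G\<lparr>carrier := N\<rparr>) (subtopology T N)"
proof -
  interpret profinite_group G T by fact
  obtain H f where H: "subgroup H G" "openin T H" "H \<noteq> carrier G"
    and f: "f \<in> iso (G\<lparr>carrier := H\<rparr>) G" "homeomorphic_map (subtopology T H) T f"
    using assms(3) unfolding open_subgroup_def topological_group_isomorphic_def by blast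
  interpret H: subgroup H G by fact
  have top: "topspace (subtopology T H) = H" using H.subset by (auto simp: topspace_eq)
  \<comment> \<open>The inverse of the isomorphism, read as a map from G to G, is the self-embedding
    with open proper image H.\<close>
  obtain g where g: "homeomorphic_maps (subtopology T H) T f g"
    using f(2) homeomorphic_map_maps by blast
  have gH: "g x \<in> H" "f (g x) = x" if "x \<in> carrier G" for x
    using g that top topspace_eq unfolding homeomorphic_maps_def continuous_map_def by auto
  have gf: "g (f y) = y" "f y \<in> carrier G" if "y \<in> H" for y
    using g that top topspace_eq unfolding homeomorphic_maps_def continuous_map_def by auto
  have f_mult: "f (x \<otimes>\<^bsub>G\<^esub> y) = f x \<otimes>\<^bsub>G\<^esub> f y" if "x \<in> H" "y \<in> H" for x y
    using f(1) that by (auto simp: iso_def hom_def)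
  have image: "g ` carrier G = H"
  proof
    show "g ` carrier G \<subseteq> H" using gH(1) by blast
    show "H \<subseteq> g ` carrier G"
    proof
      fix y assume "y \<in> H"
      then show "y \<in> g ` carrier G" using gf[of y] by (metis imageI)
    qed
  qed
  interpret open_self_embedding G T g
  proof
    show "type_F G T" by fact
    have "g (x \<otimes>\<^bsub>G\<^esub> y) = g x \<otimes>\<^bsub>G\<^esub> g y" if "x \<in> carrier G" "y \<in> carrier G" for x y
      using gf(1)[of "g x \<otimes>\<^bsub>G\<^esub> g y"] f_mult[of "g x" "g y"] gH that by simp
    then show "g \<in> hom G G" using gH(1) H.subset by (auto simp: hom_def)
    show "inj_on g (carrier G)" using gH(2) by (rule inj_on_inverseI)
    show "continuous_map T T g"
      using g unfolding homeomorphic_maps_def by (auto dest: continuous_map_into_fulltopology)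
    show "openin T (g ` carrier G)" using H(2) image by simp
  qed
  obtain N where N: "stable N" "N \<noteq> {\<one>\<^bsub>G\<^esub>}" "\<And>M. stable M \<Longrightarrow> M \<noteq> {\<one>\<^bsub>G\<^esub>} \<Longrightarrow> M \<subseteq> N \<Longrightarrow> M = N"
    using minimal_stable_exists H(3) image by metis
  interpret minimal_stable G T g N using N by unfold_locales
  obtain p where p: "Factorial_Ring.prime p" "p_part p \<noteq> {\<one>\<^bsub>G\<^esub>}" by (rule p_part_nontrivial)
  have "comm_group (G\<lparr>carrier := p_part p\<rparr>)"
    using N_abelian by (intro group.group_comm_groupI subgroup_imp_group subgroup_p_part) (auto simp: p_part_def)
  then show ?thesis using p normal_p_part infinite_p_part pro_p_p_part by blast
qed

end
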